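(* There is a (randomized) algorithm which, given an integer $k\ge 1$ and value-oracle access to an arbitrary non-negative submodular function $f:2^{E}\to\mathbb{R}_{\ge 0}$ on an $n$-element ground set $E$, outputs a set $X\subseteq E$ with $|X|\le k$ such that $f(X)\ge 0.539\cdot\max_{Y\subseteq E,\,|Y|\le k} f(Y)$ (in expectation), and whose running time and number of oracle queries are $2^{\widetilde{O}(k)}\cdot n$.
   Context: A function $f:2^E\to\mathbb{R}_{\ge0}$ is submodular if for all $S\subseteq T\subseteq E$ and $i\in E\setminus T$, $f(S\cup\{i\})-f(S)\ge f(T\cup\{i\})-f(T)$. The function is accessed only through a value oracle returning $f(S)$ for a queried set $S$. No monotonicity or symmetry of $f$ is assumed. $\widetilde{O}$ hides polylogarithmic factors in $k$. *)

theory Defs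
  imports "HOL-Probability.Probability" "HOL-Probability.SPMF" "HOL-Library.Landau_Symbols"
begin

definition submodular_on :: "'a set \<Rightarrow> ('a set \<Rightarrow> real) \<Rightarrow> bool" where
  "submodular_on E f \<longleftrightarrow>
     (\<forall>S T i. S \<subseteq> T \<and> T \<subseteq> E \<and> i \<in> E - T \<longrightarrow>
        f (insert i S) - f S \<ge> f (insert i T) - f T)"

text \<open>
  Randomized algorithms are programs of a structured real RAM with a value oracle. The memory
  consists of arrays of natural numbers (indices, counters, addresses) and arrays of reals (oracle
  values). A program mentions only finitely many array names, so this is an ordinary
  random-access memory with finitely many segments; scalars are arrays used at index 0.

  The arithmetic is restricted to what a unit-cost RAM may do in one step: addition and
  truncated subtraction on natural numbers, exact field operations and comparison on reals (no
  rounding of a real to an integer). The only constants are natural numbers, so a program is a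
  finite object and cannot hide information in a real constant.
\<close>

type_synonym name = string

datatype iexp =
    Const nat
  | IGet name iexp
  | IPlus iexp iexp
  | IMinus iexp iexp

datatype rexp =
    OfNat iexp
  | RGet name iexp
  | RPlus rexp rexp
  | RMinus rexp rexp
  | RTimes rexp rexp
  | RDivide rexp rexp

datatype bexp =
    ILess iexp iexp
  | RLess rexp rexp
  | BNot bexp
  | BAnd bexp bexp

datatype com =
    Skip
  | ISet name iexp iexp
  | RSet name iexp rexp
  | Uniform name iexp iexp
  | Coin name iexp rexp
  | Query name iexp name iexp
  | Seq com com
  | If bexp com com
  | While bexp com

record state =
  ints :: "name \<Rightarrow> nat \<Rightarrow> nat"
  reals :: "name \<Rightarrow> nat \<Rightarrow> real"
  steps :: nat
  queries :: nat

primrec ival :: "iexp \<Rightarrow> state \<Rightarrow> nat" where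
  "ival (Const m) s = m"
| "ival (IGet x a) s = ints s x (ival a s)"
| "ival (IPlus a b) s = ival a s + ival b s"
| "ival (IMinus a b) s = ival a s - ival b s"

primrec rval :: "rexp \<Rightarrow> state \<Rightarrow> real" where
  "rval (OfNat a) s = real (ival a s)"
| "rval (RGet x a) s = reals s x (ival a s)"
| "rval (RPlus a b) s = rval a s + rval b s"
| "rval (RMinus a b) s = rval a s - rval b s"
| "rval (RTimes a b) s = rval a s * rval b s"
| "rval (RDivide a b) s = rval a s / rval b s"

primrec bval :: "bexp \<Rightarrow> state \<Rightarrow> bool" where
  "bval (ILess a b) s \<longleftrightarrow> ival a s < ival b s"
| "bval (RLess a b) s \<longleftrightarrow> rval a s < rval b s"
| "bval (BNot b) s \<longleftrightarrow> \<not> bval b s"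
| "bval (BAnd b c) s \<longleftrightarrow> bval b s \<and> bval c s"

definition iwrite :: "name \<Rightarrow> nat \<Rightarrow> nat \<Rightarrow> state \<Rightarrow> state" where
  "iwrite x j v s = s\<lparr>ints := (ints s)(x := (ints s x)(j := v))\<rparr>"

definition rwrite :: "name \<Rightarrow> nat \<Rightarrow> real \<Rightarrow> state \<Rightarrow> state" where
  "rwrite x j v s = s\<lparr>reals := (reals s)(x := (reals s x)(j := v))\<rparr>"

definition tick :: "state \<Rightarrow> state" where
  "tick s = s\<lparr>steps := Suc (steps s)\<rparr>"

definition tick_query :: "state \<Rightarrow> state" where
  "tick_query s = s\<lparr>queries := Suc (queries s)\<rparr>"

definition listed_set :: "name \<Rightarrow> nat \<Rightarrow> state \<Rightarrow> nat set" where
  "listed_set x l s = ints s x ` {..<l}"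

partial_function (spmf) loop_spmf ::
  "('s \<Rightarrow> bool) \<Rightarrow> ('s \<Rightarrow> 's spmf) \<Rightarrow> 's \<Rightarrow> 's spmf" where
  "loop_spmf b c s = (if b s then bind_spmf (c s) (loop_spmf b c) else return_spmf s)"

text \<open>
  Every command and every evaluation of a guard costs one step, and so does an oracle query.
  Expressions occur literally in the program, so their size is bounded by a constant.
  Missing probability mass in the resulting subdistribution is the probability of divergence.

  \<open>Uniform x a m\<close> samples uniformly from \<open>{0, \<dots>, m}\<close> (bound included). \<open>Coin x a p\<close> stores 1 with
  probability \<open>p\<close> and 0 otherwise; \<open>bernoulli_pmf\<close> truncates \<open>p\<close> to the unit interval.
  \<open>Query y a x l\<close> queries the set of the first \<open>l\<close> entries of array \<open>x\<close> and stores the answer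
  in \<open>y[a]\<close>.
\<close>

primrec exec :: "(nat set \<Rightarrow> real) \<Rightarrow> com \<Rightarrow> state \<Rightarrow> state spmf" where
  "exec f Skip s = return_spmf (tick s)"
| "exec f (ISet x a v) s = return_spmf (tick (iwrite x (ival a s) (ival v s) s))"
| "exec f (RSet x a v) s = return_spmf (tick (rwrite x (ival a s) (rval v s) s))"
| "exec f (Uniform x a m) s =
     map_spmf (\<lambda>v. tick (iwrite x (ival a s) v s)) (spmf_of_set {..ival m s})"
| "exec f (Coin x a p) s =
     map_spmf (\<lambda>v. tick (iwrite x (ival a s) (of_bool v) s))
       (spmf_of_pmf (bernoulli_pmf (rval p s)))"
| "exec f (Query y a x l) s =
     return_spmf (tick (tick_query (rwrite y (ival a s) (f (listed_set x (ival l s) s)) s)))"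
| "exec f (Seq c d) s = bind_spmf (exec f c s) (exec f d)"
| "exec f (If b c d) s = (if bval b s then exec f c (tick s) else exec f d (tick s))"
| "exec f (While b c) s = loop_spmf (bval b) (\<lambda>s. map_spmf tick (exec f c s)) (tick s)"

text \<open>
  The size of the ground set and the cardinality bound are passed in \<open>n[0]\<close> and \<open>k[0]\<close>; the rest
  of the memory is zero. The output is the set of the first \<open>len[0]\<close> entries of array \<open>out\<close>.
\<close>

definition init_state :: "nat \<Rightarrow> nat \<Rightarrow> state" where
  "init_state n k =
     iwrite ''n'' 0 n (iwrite ''k'' 0 k
       \<lparr>ints = (\<lambda>_ _. 0), reals = (\<lambda>_ _. 0), steps = 0, queries = 0\<rparr>)"

definition out_set :: "state \<Rightarrow> nat set" where
  "out_set s = listed_set ''out'' (ints s ''len'' 0) s"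

text \<open>
  The program addresses the elements of an \<open>n\<close>-element ground set through a numbering \<open>e\<close> by
  \<open>{..<n}\<close>.
\<close>

definition run :: "com \<Rightarrow> (nat \<Rightarrow> 'a) \<Rightarrow> ('a set \<Rightarrow> real) \<Rightarrow> nat \<Rightarrow> nat \<Rightarrow> state spmf" where
  "run P e f n k = exec (\<lambda>I. f (e ` I)) P (init_state n k)"

end

theory Submission
  imports Defs "HOL-Real_Asymp.Real_Asymp"
begin

text \<open>
  Let \<open>Y\<close> be optimal and let \<open>A\<close> be the current solution. Consider the pool of the \<open>M = 10 k\<close>
  elements of largest marginal value with respect to \<open>A\<close>. If the pool contains an element of
  \<open>Y - A\<close>, then the best such element has at least the average marginal value of \<open>Y - A\<close>, and adding
  it does not change \<open>Y \<union> A\<close>. Otherwise every pool element is at least as good as each element of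
  \<open>Y - A\<close>, and by submodularity and non-negativity an average pool element decreases \<open>f (Y \<union> A)\<close> at
  most by the factor \<open>1 - 1/M\<close>. In both cases some pool element is a good greedy step, so the search
  tree of depth \<open>k\<close> that branches over the pool has a node of value at least
  \<open>(1 - 1/M)^k * (1 - (1 - 1/k)^k)\<close> times the optimum. Since the best node does as well as the average,
  no randomness is needed; exhausting the tree takes \<open>(M + 1)^k\<close> runs.
\<close>

section \<open>Deterministic programs\<close>

primrec iwritten :: "com \<Rightarrow> name set" where
  "iwritten Skip = {}"
| "iwritten (ISet x a v) = {x}"
| "iwritten (RSet x a v) = {}"
| "iwritten (Uniform x a m) = {x}"
| "iwritten (Coin x a p) = {x}"
| "iwritten (Query y a x l) = {}"
| "iwritten (Seq c d) = iwritten c \<union> iwritten d"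
| "iwritten (If b c d) = iwritten c \<union> iwritten d"
| "iwritten (While b c) = iwritten c"

primrec rwritten :: "com \<Rightarrow> name set" where
  "rwritten Skip = {}"
| "rwritten (ISet x a v) = {}"
| "rwritten (RSet x a v) = {x}"
| "rwritten (Uniform x a m) = {}"
| "rwritten (Coin x a p) = {}"
| "rwritten (Query y a x l) = {y}"
| "rwritten (Seq c d) = rwritten c \<union> rwritten d"
| "rwritten (If b c d) = rwritten c \<union> rwritten d"
| "rwritten (While b c) = rwritten c"

type_synonym imem = "name \<Rightarrow> nat \<Rightarrow> nat"
type_synonym rmem = "name \<Rightarrow> nat \<Rightarrow> real"

abbreviation mem :: "imem \<Rightarrow> rmem \<Rightarrow> nat \<Rightarrow> nat \<Rightarrow> state" where
  "mem I R st qu \<equiv> \<lparr>ints = I, reals = R, steps = st, queries = qu\<rparr>"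

definition unchanged :: "com \<Rightarrow> imem \<Rightarrow> rmem \<Rightarrow> imem \<Rightarrow> rmem \<Rightarrow> bool" where
  "unchanged c I R I' R' \<longleftrightarrow>
     (\<forall>v. v \<notin> iwritten c \<longrightarrow> I' v = I v) \<and> (\<forall>v. v \<notin> rwritten c \<longrightarrow> R' v = R v)"

definition reaches ::
  "(nat set \<Rightarrow> real) \<Rightarrow> com \<Rightarrow> imem \<Rightarrow> rmem \<Rightarrow> (imem \<Rightarrow> rmem \<Rightarrow> bool) \<Rightarrow> nat \<Rightarrow> bool" where
  "reaches h c I R Q T \<longleftrightarrow>
     (\<forall>st qu. \<exists>I' R' st' qu'. exec h c (mem I R st qu) = return_spmf (mem I' R' st' qu') \<and>
        st' \<le> st + T \<and> qu' \<le> qu + T \<and> Q I' R' \<and> unchanged c I R I' R')"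

lemma ival_mem: "ival a (mem I R st qu) = ival a (mem I R 0 0)"
  by (induction a) simp_all

lemma rval_mem: "rval a (mem I R st qu) = rval a (mem I R 0 0)"
  by (induction a) (simp_all add: ival_mem[of _ I R st qu])

lemma bval_mem: "bval b (mem I R st qu) = bval b (mem I R 0 0)"
  by (induction b) (simp_all add: ival_mem[of _ I R st qu] rval_mem[of _ I R st qu])

lemma reaches_mono:
  assumes "reaches h c I R Q T" "T \<le> T'"
    and "\<And>I' R'. Q I' R' \<Longrightarrow> unchanged c I R I' R' \<Longrightarrow> Q' I' R'"
  shows "reaches h c I R Q' T'"
  unfolding reaches_def
proof (intro allI)
  fix st qu
  obtain I' R' st' qu' where "exec h c (mem I R st qu) = return_spmf (mem I' R' st' qu')"
    "st' \<le> st + T" "qu' \<le> qu + T" "Q I' R'" "unchanged c I R I' R'"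
    using assms(1) unfolding reaches_def by blast
  moreover have "st' \<le> st + T'" "qu' \<le> qu + T'"
    using calculation assms(2) by linarith+
  ultimately show "\<exists>I' R' st' qu'. exec h c (mem I R st qu) = return_spmf (mem I' R' st' qu') \<and>
        st' \<le> st + T' \<and> qu' \<le> qu + T' \<and> Q' I' R' \<and> unchanged c I R I' R'"
    using assms(3) by (intro exI[of _ I'] exI[of _ R'] exI[of _ st'] exI[of _ qu']) simp
qed

lemma reaches_atomic:
  assumes "\<And>st qu. \<exists>qu' \<le> Suc qu. exec h c (mem I R st qu) = return_spmf (mem I' R' (Suc st) qu')"
    and "unchanged c I R I' R'" "Q I' R'"
  shows "reaches h c I R Q 1"
  unfolding reaches_def
proof (intro allI)
  fix st qu
  obtain qu' where "qu' \<le> Suc qu" "exec h c (mem I R st qu) = return_spmf (mem I' R' (Suc st) qu')"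
    using assms(1) by blast
  then show "\<exists>I' R' st' qu'. exec h c (mem I R st qu) = return_spmf (mem I' R' st' qu') \<and>
        st' \<le> st + 1 \<and> qu' \<le> qu + 1 \<and> Q I' R' \<and> unchanged c I R I' R'"
    using assms(2,3) by (intro exI[of _ I'] exI[of _ R'] exI[of _ "Suc st"] exI[of _ qu']) simp
qed

lemma reaches_Skip: "Q I R \<Longrightarrow> reaches h Skip I R Q 1"
  by (rule reaches_atomic) (auto simp: tick_def unchanged_def intro: le_SucI)

lemma reaches_ISet:
  assumes "Q (I(x := (I x)(ival a (mem I R 0 0) := ival v (mem I R 0 0)))) R"
  shows "reaches h (ISet x a v) I R Q 1"
proof (rule reaches_atomic)
  fix st qu
  show "\<exists>qu' \<le> Suc qu. exec h (ISet x a v) (mem I R st qu) = return_spmf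
    (mem (I(x := (I x)(ival a (mem I R 0 0) := ival v (mem I R 0 0)))) R (Suc st) qu')"
    by (intro exI[of _ qu])
      (simp add: tick_def iwrite_def ival_mem[of a I R st qu] ival_mem[of v I R st qu])
qed (use assms in \<open>auto simp: unchanged_def\<close>)

lemma reaches_RSet:
  assumes "Q I (R(x := (R x)(ival a (mem I R 0 0) := rval v (mem I R 0 0))))"
  shows "reaches h (RSet x a v) I R Q 1"
proof (rule reaches_atomic)
  fix st qu
  show "\<exists>qu' \<le> Suc qu. exec h (RSet x a v) (mem I R st qu) = return_spmf
    (mem I (R(x := (R x)(ival a (mem I R 0 0) := rval v (mem I R 0 0)))) (Suc st) qu')"
    by (intro exI[of _ qu])
      (simp add: tick_def rwrite_def ival_mem[of a I R st qu] rval_mem[of v I R st qu])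
qed (use assms in \<open>auto simp: unchanged_def\<close>)

lemma reaches_Query:
  assumes "Q I (R(y := (R y)(ival a (mem I R 0 0) := h (I x ` {..<ival l (mem I R 0 0)}))))"
  shows "reaches h (Query y a x l) I R Q 1"
proof (rule reaches_atomic)
  fix st qu
  show "\<exists>qu' \<le> Suc qu. exec h (Query y a x l) (mem I R st qu) = return_spmf
    (mem I (R(y := (R y)(ival a (mem I R 0 0) := h (I x ` {..<ival l (mem I R 0 0)})))) (Suc st) qu')"
    by (intro exI[of _ "Suc qu"])
      (simp add: tick_def tick_query_def rwrite_def listed_set_def
        ival_mem[of a I R st qu] ival_mem[of l I R st qu])
qed (use assms in \<open>auto simp: unchanged_def\<close>)

lemma reaches_Seq:
  assumes "reaches h c I R Q T"
    and "\<And>I' R'. Q I' R' \<Longrightarrow> unchanged c I R I' R' \<Longrightarrow> reaches h d I' R' Q' T'"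
  shows "reaches h (Seq c d) I R Q' (T + T')"
  unfolding reaches_def
proof (intro allI)
  fix st qu
  obtain I1 R1 st1 qu1 where 1: "exec h c (mem I R st qu) = return_spmf (mem I1 R1 st1 qu1)"
    "st1 \<le> st + T" "qu1 \<le> qu + T" "Q I1 R1" "unchanged c I R I1 R1"
    using assms(1) unfolding reaches_def by blast
  obtain I2 R2 st2 qu2 where 2: "exec h d (mem I1 R1 st1 qu1) = return_spmf (mem I2 R2 st2 qu2)"
    "st2 \<le> st1 + T'" "qu2 \<le> qu1 + T'" "Q' I2 R2" "unchanged d I1 R1 I2 R2"
    using assms(2)[OF 1(4,5)] unfolding reaches_def by blast
  have "unchanged (Seq c d) I R I2 R2"
    using 1(5) 2(5) by (simp add: unchanged_def)
  then show "\<exists>I' R' st' qu'. exec h (Seq c d) (mem I R st qu) = return_spmf (mem I' R' st' qu') \<and>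
        st' \<le> st + (T + T') \<and> qu' \<le> qu + (T + T') \<and> Q' I' R' \<and> unchanged (Seq c d) I R I' R'"
    using 1 2 by (intro exI[of _ I2] exI[of _ R2] exI[of _ st2] exI[of _ qu2]) simp
qed

lemma reaches_If:
  assumes "bval b (mem I R 0 0) \<Longrightarrow> reaches h c I R Q T"
    and "\<not> bval b (mem I R 0 0) \<Longrightarrow> reaches h d I R Q T"
  shows "reaches h (If b c d) I R Q (Suc T)"
  unfolding reaches_def
proof (intro allI)
  fix st qu
  define c' where "c' = (if bval b (mem I R 0 0) then c else d)"
  have "reaches h c' I R Q T"
    using assms by (simp add: c'_def)
  then obtain I' R' st' qu' where
    1: "exec h c' (mem I R (Suc st) qu) = return_spmf (mem I' R' st' qu')"
    "st' \<le> Suc st + T" "qu' \<le> qu + T" "Q I' R'" "unchanged c' I R I' R'"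
    unfolding reaches_def by blast
  have "exec h (If b c d) (mem I R st qu) = return_spmf (mem I' R' st' qu')"
    using 1(1) by (simp add: bval_mem[of b I R st qu] tick_def c'_def split: if_splits)
  moreover have "unchanged (If b c d) I R I' R'"
    using 1(5) by (auto simp: unchanged_def c'_def split: if_splits)
  ultimately show "\<exists>I' R' st' qu'. exec h (If b c d) (mem I R st qu) = return_spmf (mem I' R' st' qu') \<and>
        st' \<le> st + Suc T \<and> qu' \<le> qu + Suc T \<and> Q I' R' \<and> unchanged (If b c d) I R I' R'"
    using 1 by (intro exI[of _ I'] exI[of _ R'] exI[of _ st'] exI[of _ qu']) simp
qed

lemma reaches_While:
  assumes "Inv 0 I R"
    and step: "\<And>i I' R'. i < N \<Longrightarrow> Inv i I' R' \<Longrightarrow> unchanged c I R I' R' \<Longrightarrow>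
           bval b (mem I' R' 0 0) \<and> reaches h c I' R' (Inv (Suc i)) T"
    and stop: "\<And>I' R'. Inv N I' R' \<Longrightarrow> unchanged c I R I' R' \<Longrightarrow> \<not> bval b (mem I' R' 0 0)"
  shows "reaches h (While b c) I R (Inv N) (1 + N * (T + 1))"
proof -
  let ?L = "loop_spmf (bval b) (\<lambda>s. map_spmf tick (exec h c s))"
  have loop: "\<exists>I2 R2 st2 qu2. ?L (mem I1 R1 st qu) = return_spmf (mem I2 R2 st2 qu2) \<and>
      st2 \<le> st + m * (T + 1) \<and> qu2 \<le> qu + m * (T + 1) \<and> Inv N I2 R2 \<and> unchanged c I R I2 R2"
    if "Inv i I1 R1" "unchanged c I R I1 R1" "i + m = N" for i m I1 R1 st qu
    using that
  proof (induction m arbitrary: i I1 R1 st qu)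
    case 0
    then have "?L (mem I1 R1 st qu) = return_spmf (mem I1 R1 st qu)"
      using stop by (subst loop_spmf.simps) (simp add: bval_mem[of b I1 R1 st qu])
    then show ?case
      using 0 by auto
  next
    case (Suc m)
    then have "i < N" by simp
    from step[OF this Suc.prems(1,2)] have b: "bval b (mem I1 R1 0 0)"
      and "reaches h c I1 R1 (Inv (Suc i)) T" by auto
    then obtain I' R' st' qu' where
      1: "exec h c (mem I1 R1 st qu) = return_spmf (mem I' R' st' qu')"
      "st' \<le> st + T" "qu' \<le> qu + T" "Inv (Suc i) I' R'" "unchanged c I1 R1 I' R'"
      unfolding reaches_def by blast
    have "?L (mem I1 R1 st qu) = ?L (mem I' R' (Suc st') qu')"
      using b 1(1) by (subst loop_spmf.simps) (simp add: bval_mem[of b I1 R1 st qu] tick_def)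
    moreover have "unchanged c I R I' R'"
      using Suc.prems(2) 1(5) by (simp add: unchanged_def)
    moreover obtain I2 R2 st2 qu2 where
      "?L (mem I' R' (Suc st') qu') = return_spmf (mem I2 R2 st2 qu2)"
      "st2 \<le> Suc st' + m * (T + 1)" "qu2 \<le> qu' + m * (T + 1)" "Inv N I2 R2" "unchanged c I R I2 R2"
      using Suc.IH[OF 1(4) calculation(2)] Suc.prems(3) by force
    ultimately show ?case
      using 1 by (intro exI[of _ I2] exI[of _ R2] exI[of _ st2] exI[of _ qu2]) simp
  qed
  show ?thesis
    unfolding reaches_def
  proof (intro allI)
    fix st qu
    obtain I2 R2 st2 qu2 where "?L (mem I R (Suc st) qu) = return_spmf (mem I2 R2 st2 qu2)"
      "st2 \<le> Suc st + N * (T + 1)" "qu2 \<le> qu + N * (T + 1)" "Inv N I2 R2" "unchanged c I R I2 R2"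
      using loop[OF assms(1), of N "Suc st" qu] by (force simp: unchanged_def)
    then show "\<exists>I' R' st' qu'. exec h (While b c) (mem I R st qu) = return_spmf (mem I' R' st' qu') \<and>
        st' \<le> st + (1 + N * (T + 1)) \<and> qu' \<le> qu + (1 + N * (T + 1)) \<and> Inv N I' R' \<and>
        unchanged (While b c) I R I' R'"
      by (intro exI[of _ I2] exI[of _ R2] exI[of _ st2] exI[of _ qu2])
        (simp add: tick_def unchanged_def)
  qed
qed

lemma unchangedD:
  "unchanged c I R I' R' \<Longrightarrow> v \<notin> iwritten c \<Longrightarrow> I' v = I v"
  "unchanged c I R I' R' \<Longrightarrow> v \<notin> rwritten c \<Longrightarrow> R' v = R v"
  by (simp_all add: unchanged_def)

lemma reaches_cost: "reaches h c I R Q T \<Longrightarrow> T \<le> T' \<Longrightarrow> reaches h c I R Q T'"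
  by (erule reaches_mono)

lemma reaches_ISet_Seq:
  assumes "reaches h d (I(x := (I x)(ival a (mem I R 0 0) := ival v (mem I R 0 0)))) R Q T"
  shows "reaches h (Seq (ISet x a v) d) I R Q (1 + T)"
  using assms
  by (intro reaches_Seq[OF reaches_ISet[of "\<lambda>I' R'. I' = _ \<and> R' = R", OF conjI[OF refl refl]]]) auto

primrec straight :: "com \<Rightarrow> bool" where
  "straight Skip \<longleftrightarrow> True"
| "straight (ISet x a v) \<longleftrightarrow> True"
| "straight (RSet x a v) \<longleftrightarrow> True"
| "straight (Uniform x a m) \<longleftrightarrow> False"
| "straight (Coin x a p) \<longleftrightarrow> False"
| "straight (Query y a x l) \<longleftrightarrow> True"
| "straight (Seq c d) \<longleftrightarrow> straight c \<and> straight d"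
| "straight (If b c d) \<longleftrightarrow> straight c \<and> straight d"
| "straight (While b c) \<longleftrightarrow> False"

primrec cost :: "com \<Rightarrow> nat" where
  "cost Skip = 1"
| "cost (ISet x a v) = 1"
| "cost (RSet x a v) = 1"
| "cost (Uniform x a m) = 1"
| "cost (Coin x a p) = 1"
| "cost (Query y a x l) = 1"
| "cost (Seq c d) = cost c + cost d"
| "cost (If b c d) = Suc (max (cost c) (cost d))"
| "cost (While b c) = 0"

primrec wp ::
  "(nat set \<Rightarrow> real) \<Rightarrow> com \<Rightarrow> (imem \<Rightarrow> rmem \<Rightarrow> bool) \<Rightarrow> imem \<Rightarrow> rmem \<Rightarrow> bool" where
  "wp h Skip Q I R \<longleftrightarrow> Q I R"
| "wp h (ISet x a v) Q I R \<longleftrightarrow>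
     Q (I(x := (I x)(ival a (mem I R 0 0) := ival v (mem I R 0 0)))) R"
| "wp h (RSet x a v) Q I R \<longleftrightarrow>
     Q I (R(x := (R x)(ival a (mem I R 0 0) := rval v (mem I R 0 0))))"
| "wp h (Uniform x a m) Q I R \<longleftrightarrow> False"
| "wp h (Coin x a p) Q I R \<longleftrightarrow> False"
| "wp h (Query y a x l) Q I R \<longleftrightarrow>
     Q I (R(y := (R y)(ival a (mem I R 0 0) := h (I x ` {..<ival l (mem I R 0 0)}))))"
| "wp h (Seq c d) Q I R \<longleftrightarrow> wp h c (wp h d Q) I R"
| "wp h (If b c d) Q I R \<longleftrightarrow>
     (if bval b (mem I R 0 0) then wp h c Q I R else wp h d Q I R)"
| "wp h (While b c) Q I R \<longleftrightarrow> False"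

lemma reaches_wp:
  assumes "straight c" "wp h c Q I R"
  shows "reaches h c I R Q (cost c)"
  using assms
proof (induction c arbitrary: Q I R)
  case Skip
  then show ?case using reaches_Skip by simp
next
  case (ISet x a v)
  then show ?case using reaches_ISet[of Q I x a R v h] by simp
next
  case (RSet x a v)
  then show ?case using reaches_RSet[of Q I R x a v h] by simp
next
  case (Query y a x l)
  then show ?case using reaches_Query[of Q I R y a h x l] by simp
next
  case (Seq c d)
  then show ?case
    by (auto intro!: reaches_Seq[where Q = "wp h d Q"])
next
  case (If b c d)
  have "reaches h c I R Q (max (cost c) (cost d))" if "bval b (mem I R 0 0)"
    using If that by (intro reaches_cost[OF If.IH(1)]) auto
  moreover have "reaches h d I R Q (max (cost c) (cost d))" if "\<not> bval b (mem I R 0 0)"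
    using If that by (intro reaches_cost[OF If.IH(2)]) auto
  ultimately show ?case
    unfolding cost.simps by (rule reaches_If)
qed simp_all

lemma reaches_straight:
  assumes "straight c" "cost c \<le> T" "wp h c Q I R"
  shows "reaches h c I R Q T"
  using assms reaches_cost reaches_wp by blast

section \<open>The search tree\<close>

text \<open>The value \<open>n\<close>, which is not an element of the ground set \<open>{..<n}\<close>, means that nothing was found.\<close>

primrec scan :: "(nat set \<Rightarrow> real) \<Rightarrow> nat \<Rightarrow> nat set \<Rightarrow> nat set \<Rightarrow> nat \<Rightarrow> nat" where
  "scan h n U A 0 = n"
| "scan h n U A (Suc i) =
     (if i \<in> U \<or> (scan h n U A i < n \<and> h (insert i A) \<le> h (insert (scan h n U A i) A))
      then scan h n U A i else i)"

primrec marked :: "(nat set \<Rightarrow> real) \<Rightarrow> nat \<Rightarrow> nat set \<Rightarrow> nat \<Rightarrow> nat set" where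
  "marked h n A 0 = A"
| "marked h n A (Suc j) = insert (scan h n (marked h n A j) A n) (marked h n A j)"

text \<open>The branches below a node are numbered from 1; branch 0 leaves the set as it is.\<close>

definition ranked :: "(nat set \<Rightarrow> real) \<Rightarrow> nat \<Rightarrow> nat set \<Rightarrow> nat \<Rightarrow> nat" where
  "ranked h n A c = (if c = 0 then n else scan h n (marked h n A (c - 1)) A n)"

definition extend :: "(nat set \<Rightarrow> real) \<Rightarrow> nat \<Rightarrow> nat set \<Rightarrow> nat \<Rightarrow> nat set" where
  "extend h n A c = (if ranked h n A c < n then insert (ranked h n A c) A else A)"

primrec climb :: "(nat set \<Rightarrow> real) \<Rightarrow> nat \<Rightarrow> nat \<Rightarrow> nat \<Rightarrow> nat set \<Rightarrow> nat \<Rightarrow> nat set" where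
  "climb h n B 0 A q = A"
| "climb h n B (Suc r) A q = climb h n B r (extend h n A (q mod B)) (q div B)"

lemma climb_0: "climb h n B r A 0 = A"
  by (induction r) (simp_all add: extend_def ranked_def)

lemma scan_correct:
  assumes "i \<le> n"
  shows "if {..<i} \<subseteq> U then scan h n U A i = n
    else scan h n U A i < i \<and> scan h n U A i \<notin> U \<and>
      (\<forall>l<i. l \<notin> U \<longrightarrow> h (insert l A) \<le> h (insert (scan h n U A i) A))"
  using assms
proof (induction i)
  case 0
  then show ?case by simp
next
  case (Suc i)
  then show ?case
    by (auto simp: lessThan_Suc less_Suc_eq split: if_splits)
qed

lemma scan_max:
  assumes "l < n" "l \<notin> U"
  shows "scan h n U A n < n" "scan h n U A n \<notin> U"
    "h (insert l A) \<le> h (insert (scan h n U A n) A)"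
  using scan_correct[of n n U h A] assms by (auto split: if_splits)

lemma marked_mono: "i \<le> j \<Longrightarrow> marked h n A i \<subseteq> marked h n A j"
  by (rule lift_Suc_mono_le) auto

lemma marked_eq: "marked h n A j = A \<union> ranked h n A ` {1..j}"
proof (induction j)
  case (Suc j)
  have "ranked h n A (Suc j) = scan h n (marked h n A j) A n"
    by (simp add: ranked_def)
  then show ?case
    using Suc by (simp add: atLeastAtMostSuc_conv)
qed simp

definition decay :: "nat \<Rightarrow> nat \<Rightarrow> real" where
  "decay k r = (1 - 1 / real k) ^ r"

primrec gain :: "nat \<Rightarrow> nat \<Rightarrow> nat \<Rightarrow> real" where
  "gain k M 0 = 0"
| "gain k M (Suc r) = decay k r / real k + (1 - 1 / real M) * gain k M r"

lemma decay_nonneg: "k \<ge> 1 \<Longrightarrow> 0 \<le> decay k r"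
  by (simp add: decay_def)

lemma gain_nonneg: "k \<ge> 1 \<Longrightarrow> M \<ge> 1 \<Longrightarrow> 0 \<le> gain k M r"
  by (induction r) (auto simp: decay_nonneg intro!: add_nonneg_nonneg mult_nonneg_nonneg)

lemma decay_gain_le_1:
  assumes "k \<ge> 1" "M \<ge> 1"
  shows "decay k r + gain k M r \<le> 1"
proof (induction r)
  case (Suc r)
  have "(1 - 1 / real M) * gain k M r \<le> gain k M r"
    using gain_nonneg[OF assms, of r] by (intro mult_left_le_one_le) (use assms in auto)
  then show ?case
    using Suc by (simp add: decay_def field_simps)
qed (simp add: decay_def)

lemma gain_ge:
  assumes "k \<ge> 1" "M \<ge> 1"
  shows "gain k M r \<ge> (1 - 1 / real M) ^ r * (1 - decay k r)"
proof (induction r)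
  case (Suc r)
  let ?a = "1 - 1 / real M"
  have a: "0 \<le> ?a" "?a \<le> 1" using assms by auto
  have "?a ^ Suc r * (1 - decay k (Suc r)) =
      ?a ^ Suc r * (decay k r / real k) + ?a * (?a ^ r * (1 - decay k r))"
    by (simp add: decay_def algebra_simps)
  also have "\<dots> \<le> 1 * (decay k r / real k) + ?a * gain k M r"
    using a Suc decay_nonneg[OF assms(1), of r]
    by (intro add_mono mult_right_mono mult_left_mono power_le_one) auto
  finally show ?case by simp
qed (simp add: decay_def)

lemma gain_ge_0539:
  assumes "k \<ge> 1"
  shows "gain k (10 * k) k \<ge> 0.539"
proof -
  have "decay k k \<le> exp (- (1 / real k)) ^ k"
    unfolding decay_def using exp_ge_add_one_self[of "- (1 / real k)"] assms
    by (intro power_mono) auto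
  also have "\<dots> = exp (-1)"
    using assms by (simp flip: exp_of_nat_mult)
  also have "\<dots> \<le> 1 / 2.5"
  proof -
    have "exp (1::real) \<ge> 2.5"
      using exp_lower_Taylor_quadratic[of 1] by simp
    then show ?thesis
      by (simp add: exp_minus divide_simps)
  qed
  finally have 1: "0.6 \<le> 1 - decay k k" by simp
  have 2: "(1 - 1 / real (10 * k)) ^ k \<ge> 0.9"
    using Bernoulli_inequality[of "- 1 / real (10 * k)" k] assms by simp
  have "0.539 \<le> 0.9 * (0.6 :: real)" by simp
  also have "\<dots> \<le> (1 - 1 / real (10 * k)) ^ k * (1 - decay k k)"
    using 1 2 by (intro mult_mono) auto
  also have "\<dots> \<le> gain k (10 * k) k"
    using gain_ge[of k "10 * k" k] assms by simp
  finally show ?thesis .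
qed

lemma submodular_on_sum_marginals:
  assumes "submodular_on E h" "finite Q" "T \<subseteq> E" "Q \<subseteq> E - T"
  shows "h (T \<union> Q) - h T \<le> (\<Sum>q\<in>Q. h (insert q T) - h T)"
  using assms(2,4)
proof (induction Q rule: finite_induct)
  case (insert q Q)
  have "h (insert q T) - h T \<ge> h (insert q (T \<union> Q)) - h (T \<union> Q)"
    using assms(1,3) insert by (intro assms(1)[unfolded submodular_on_def, rule_format]) auto
  then show ?case
    using insert by simp
qed simp

lemma best_marginal_ge:
  assumes sub: "submodular_on E h" and "finite E" "A \<subseteq> E" "Y \<subseteq> E" "card Y \<le> k" "k \<ge> 1"
    and less: "h A < h (Y \<union> A)"
    and max: "\<And>y. y \<in> Y - A \<Longrightarrow> h (insert y A) \<le> v"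
  shows "v \<ge> (1 - 1 / real k) * h A + h (Y \<union> A) / real k"
proof -
  have fin: "finite (Y - A)" using assms finite_subset by blast
  have *: "h (Y \<union> A) - h A \<le> (\<Sum>y\<in>Y - A. h (insert y A) - h A)"
    using submodular_on_sum_marginals[OF sub fin, of A] assms by (auto simp: Un_commute)
  also have "\<dots> \<le> (\<Sum>y\<in>Y - A. v - h A)"
    using max by (intro sum_mono) simp
  finally have 1: "h (Y \<union> A) - h A \<le> real (card (Y - A)) * (v - h A)" by simp
  then have "v - h A \<ge> 0"
    using less by (smt (verit) mult_nonneg_nonpos of_nat_0_le_iff)
  moreover have "card (Y - A) \<le> k"
    using assms by (meson Diff_subset card_mono finite_subset le_trans)
  ultimately have "real (card (Y - A)) * (v - h A) \<le> real k * (v - h A)"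
    by (intro mult_right_mono) auto
  with 1 show ?thesis
    using \<open>k \<ge> 1\<close> by (simp add: field_simps)
qed

lemma sum_insert_ge:
  assumes "submodular_on E h" "\<And>S. S \<subseteq> E \<Longrightarrow> 0 \<le> h S" "finite Q" "T \<subseteq> E" "Q \<subseteq> E - T"
  shows "(\<Sum>q\<in>Q. h (insert q T)) \<ge> (real (card Q) - 1) * h T"
proof -
  have "0 \<le> h (T \<union> Q)" using assms(4,5) by (intro assms(2)) auto
  then show ?thesis
    using submodular_on_sum_marginals[OF assms(1,3-5)] by (simp add: sum_subtractf algebra_simps)
qed

text \<open>
  The guarantee is linear in \<open>h A\<close> and \<open>h (Y \<union> A)\<close> so that it can be averaged over the pool.
\<close>

lemma climb_ge:
  assumes sub: "submodular_on {..<n} h" and nonneg: "\<And>S. S \<subseteq> {..<n} \<Longrightarrow> 0 \<le> h S"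
    and Y: "Y \<subseteq> {..<n}" "card Y \<le> k" and k: "k \<ge> 1" and M: "M \<ge> 1"
    and A: "A \<subseteq> {..<n}"
  shows "\<exists>q < (M + 1) ^ r.
    h (climb h n (M + 1) r A q) \<ge> decay k r * h A + gain k M r * h (Y \<union> A)"
  using A
proof (induction r arbitrary: A)
  case 0
  then show ?case by (simp add: decay_def)
next
  case (Suc r)
  let ?B = "M + 1"
  let ?D = "decay k" and ?G = "gain k M"
  have D: "0 \<le> ?D r" using k by (rule decay_nonneg)
  have G: "0 \<le> ?G r" using k M by (rule gain_nonneg)
  let ?target = "?D (Suc r) * h A + ?G (Suc r) * h (Y \<union> A)"
  have YA: "Y \<union> A \<subseteq> {..<n}" using Y Suc.prems by simp
  show ?case
  proof (cases "h (Y \<union> A) \<le> h A")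
    case True
    have "?target \<le> ?D (Suc r) * h A + ?G (Suc r) * h A"
      using True gain_nonneg[OF k M] by (intro add_left_mono mult_left_mono)
    also have "\<dots> \<le> h A"
      using decay_gain_le_1[OF k M, of "Suc r"] nonneg[OF Suc.prems]
        mult_right_mono[of _ 1 "h A"] by (simp flip: distrib_right)
    finally show ?thesis
      by (intro exI[of _ 0]) (simp add: climb_0 del: climb.simps gain.simps)
  next
    case False
    let ?x = "ranked h n A" and ?V = "(1 - 1 / real k) * h A + h (Y \<union> A) / real k"
    have descend: "\<exists>q < ?B ^ Suc r. h (climb h n ?B (Suc r) A q) \<ge>
        ?D r * h (insert (?x c) A) + ?G r * h (Y \<union> insert (?x c) A)"
      if c: "c \<le> M" "?x c < n" for c
    proof -
      have ext: "extend h n A c = insert (?x c) A"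
        using c by (simp add: extend_def)
      obtain q where q: "q < ?B ^ r" "h (climb h n ?B r (insert (?x c) A) q) \<ge>
        ?D r * h (insert (?x c) A) + ?G r * h (Y \<union> insert (?x c) A)"
        using Suc.IH[of "insert (?x c) A"] Suc.prems c(2) by blast
      have "c + ?B * q < ?B ^ Suc r"
      proof -
        have "c + ?B * q < ?B * Suc q" using c(1) by simp
        also have "\<dots> \<le> ?B * ?B ^ r" using q(1) by (intro mult_le_mono) auto
        finally show ?thesis by simp
      qed
      moreover have "(c + ?B * q) mod ?B = c" "(c + ?B * q) div ?B = q"
        using c(1) by (simp_all del: add_Suc_right One_nat_def mult_Suc)
      ultimately show ?thesis
        using q(2) ext by (intro exI[of _ "c + ?B * q"]) simp
    qed
    have target: "?target = ?D r * ?V + (1 - 1 / real M) * ?G r * h (Y \<union> A)"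
      by (simp add: decay_def algebra_simps)
    have marginal: "?x (Suc j) < n" "?x (Suc j) \<notin> marked h n A j"
        "h (insert (?x (Suc j)) A) \<ge> ?V"
      if "marked h n A j \<inter> Y \<subseteq> A" for j
    proof -
      have x: "?x (Suc j) = scan h n (marked h n A j) A n"
        by (simp add: ranked_def)
      have un: "y < n" "y \<notin> marked h n A j" if "y \<in> Y - A" for y
        using that \<open>marked h n A j \<inter> Y \<subseteq> A\<close> Y by auto
      have "Y - A \<noteq> {}"
        using False by (metis Diff_eq_empty_iff order_refl sup.absorb2)
      then show "?x (Suc j) < n" "?x (Suc j) \<notin> marked h n A j"
        using un scan_max(1,2) unfolding x by blast+
      show "h (insert (?x (Suc j)) A) \<ge> ?V"
        using False un scan_max(3) Y k Suc.prems unfolding x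
        by (intro best_marginal_ge[OF sub]) auto
    qed
    show ?thesis
    proof (cases "marked h n A M \<inter> Y \<subseteq> A")
      case hit: False
      define j where "j = (LEAST j. \<not> marked h n A j \<inter> Y \<subseteq> A)"
      have j: "\<not> marked h n A j \<inter> Y \<subseteq> A" "j \<le> M"
        unfolding j_def using LeastI[of "\<lambda>j. \<not> marked h n A j \<inter> Y \<subseteq> A", OF hit]
          Least_le[of "\<lambda>j. \<not> marked h n A j \<inter> Y \<subseteq> A", OF hit] by auto
      then obtain i where i: "j = Suc i"
        by (cases j) auto
      have sub_i: "marked h n A i \<inter> Y \<subseteq> A"
        using not_less_Least[of i "\<lambda>j. \<not> marked h n A j \<inter> Y \<subseteq> A"] i j_def by auto
      have "?x j \<in> Y"
        using j(1) sub_i unfolding i by (auto simp: ranked_def)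
      then have "Y \<union> insert (?x j) A = Y \<union> A" by auto
      moreover have "(1 - 1 / real M) * (?G r * h (Y \<union> A)) \<le> ?G r * h (Y \<union> A)"
        using G nonneg[OF YA] M by (intro mult_left_le_one_le) auto
      moreover have "?D r * ?V \<le> ?D r * h (insert (?x j) A)"
        using marginal(3)[OF sub_i] D unfolding i by (rule mult_left_mono)
      ultimately have "?target \<le> ?D r * h (insert (?x j) A) + ?G r * h (Y \<union> insert (?x j) A)"
        unfolding target by (simp only: mult.assoc)
      then show ?thesis
        using descend[OF j(2)] marginal(1)[OF sub_i] unfolding i
        by (meson order_trans)
    next
      case miss: True
      have pool: "?x c < n" "?x c \<notin> marked h n A (c - 1)" "h (insert (?x c) A) \<ge> ?V"
        if "c \<in> {1..M}" for c
        using that marginal[of "c - 1"] marked_mono[of "c - 1" M h n A] miss by force+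
      have inj: "inj_on ?x {1..M}"
      proof (rule linorder_inj_onI)
        fix c d assume "c < d" "c \<in> {1..M}" "d \<in> {1..M}"
        then show "?x c \<noteq> ?x d"
          using pool(2)[of d] marked_eq[of h n A "d - 1"]
          by (metis UnCI atLeastAtMost_iff imageI Suc_diff_1 less_Suc_eq_le not_one_le_zero not_gr_zero)
      qed (rule linear)
      let ?P = "?x ` {1..M}"
      have P: "?P \<subseteq> {..<n} - (Y \<union> A)"
      proof
        fix p assume "p \<in> ?P"
        then obtain c where c: "c \<in> {1..M}" "p = ?x c" by auto
        have "p \<notin> A"
          using pool(2)[OF c(1)] marked_mono[of 0 "c - 1" h n A] c by auto
        moreover have "p \<in> marked h n A M"
          using c marked_eq by auto
        ultimately show "p \<in> {..<n} - (Y \<union> A)"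
          using miss pool(1)[OF c(1)] c by auto
      qed
      let ?W = "\<lambda>c. ?D r * h (insert (?x c) A) + ?G r * h (Y \<union> insert (?x c) A)"
      have sum_W: "real M * ?target \<le> sum ?W {1..M}"
      proof -
        have "(real M - 1) * h (Y \<union> A) \<le> (\<Sum>c\<in>{1..M}. h (insert (?x c) (Y \<union> A)))"
          using sum_insert_ge[OF sub nonneg _ YA P] inj
          by (simp add: sum.reindex card_image)
        then have "?G r * ((real M - 1) * h (Y \<union> A)) \<le> (\<Sum>c\<in>{1..M}. ?G r * h (Y \<union> insert (?x c) A))"
          using G by (simp add: mult_left_mono flip: sum_distrib_left)
        moreover have "real M * (?D r * ?V) \<le> (\<Sum>c\<in>{1..M}. ?D r * h (insert (?x c) A))"
          using sum_mono[of "{1..M}" "\<lambda>_. ?D r * ?V"] pool(3) D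
          by (simp add: mult_left_mono)
        moreover have "real M * ?target = real M * (?D r * ?V) + ?G r * ((real M - 1) * h (Y \<union> A))"
          unfolding target using M by (simp add: field_simps)
        ultimately show ?thesis by (simp add: sum.distrib)
      qed
      have "\<exists>c\<in>{1..M}. ?target \<le> ?W c"
      proof (rule ccontr)
        assume "\<not> ?thesis"
        then have "sum ?W {1..M} < (\<Sum>c\<in>{1..M}. ?target)"
          using M by (intro sum_strict_mono) (auto simp: not_le simp del: gain.simps)
        with sum_W show False by simp
      qed
      then show ?thesis
        using descend pool(1) by (meson atLeastAtMost_iff order_trans)
    qed
  qed
qed

section \<open>The program\<close>

primrec scaled :: "nat \<Rightarrow> iexp \<Rightarrow> iexp" where
  "scaled 0 a = Const 0"
| "scaled (Suc c) a = IPlus a (scaled c a)"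

lemma ival_scaled [simp]: "ival (scaled c a) s = c * ival a s"
  by (induction c) simp_all

abbreviation Var :: "name \<Rightarrow> iexp" where
  "Var x \<equiv> IGet x (Const 0)"

abbreviation Assign :: "name \<Rightarrow> iexp \<Rightarrow> com" where
  "Assign x a \<equiv> ISet x (Const 0) a"

abbreviation Incr :: "name \<Rightarrow> com" where
  "Incr x \<equiv> Assign x (IPlus (Var x) (Const 1))"

definition scan_body :: com where
  "scan_body =
     Seq (Incr ''i'')
       (If (ILess (IGet ''mark'' (IMinus (Var ''i'') (Const 1))) (Const 1))
         (Seq (ISet ''a'' (Var ''m'') (IMinus (Var ''i'') (Const 1)))
         (Seq (Query ''v'' (Const 0) ''a'' (IPlus (Var ''m'') (Const 1)))
           (If (BAnd (ILess (Var ''x'') (Var ''n'')) (BNot (RLess (RGet ''w'' (Const 0)) (RGet ''v'' (Const 0)))))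
             Skip
             (Seq (Assign ''x'' (IMinus (Var ''i'') (Const 1)))
               (RSet ''w'' (Const 0) (RGet ''v'' (Const 0)))))))
         Skip)"

definition scan_com :: com where
  "scan_com = Seq (Assign ''x'' (Var ''n'')) (Seq (Assign ''i'' (Const 0))
     (While (ILess (Var ''i'') (Var ''n'')) scan_body))"

definition rank_body :: com where
  "rank_body = Seq scan_com (Seq (ISet ''mark'' (Var ''x'') (Const 1)) (Incr ''j''))"

definition rank_com :: com where
  "rank_com = Seq (Assign ''x'' (Var ''n'')) (Seq (Assign ''j'' (Const 0))
     (While (ILess (Var ''j'') (Var ''c'')) rank_body))"

definition mark_com :: com where
  "mark_com = Seq (Assign ''i'' (Const 0)) (Seq
     (While (ILess (Var ''i'') (Var ''n'')) (Seq (ISet ''mark'' (Var ''i'') (Const 0)) (Incr ''i'')))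
     (Seq (Assign ''i'' (Const 0))
     (While (ILess (Var ''i'') (Var ''m''))
       (Seq (ISet ''mark'' (IGet ''a'' (Var ''i'')) (Const 1)) (Incr ''i'')))))"

definition digit_com :: com where
  "digit_com = Seq (Assign ''c'' (Var ''q'')) (Seq (Assign ''q'' (Const 0))
     (While (BNot (ILess (Var ''c'') (Var ''B'')))
       (Seq (Assign ''c'' (IMinus (Var ''c'') (Var ''B''))) (Incr ''q''))))"

definition round_com :: com where
  "round_com = Seq digit_com (Seq mark_com (Seq rank_com (Seq (Incr ''t'')
     (If (ILess (Var ''x'') (Var ''n''))
       (Seq (ISet ''a'' (Var ''m'') (Var ''x'')) (Incr ''m'')) Skip))))"

definition climb_com :: com where
  "climb_com = Seq (Assign ''m'' (Const 0)) (Seq (Assign ''q'' (Var ''N'')) (Seq (Assign ''t'' (Const 0))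
     (While (ILess (Var ''t'') (Var ''k'')) round_com)))"

definition copy_com :: com where
  "copy_com = Seq (Assign ''len'' (Var ''m'')) (Seq (Assign ''i'' (Const 0))
     (While (ILess (Var ''i'') (Var ''m''))
       (Seq (ISet ''out'' (Var ''i'') (IGet ''a'' (Var ''i''))) (Incr ''i''))))"

definition try_com :: com where
  "try_com = Seq climb_com (Seq (Query ''v'' (Const 0) ''a'' (Var ''m'')) (Seq (Incr ''N'')
     (If (RLess (RGet ''best'' (Const 0)) (RGet ''v'' (Const 0)))
       (Seq (RSet ''best'' (Const 0) (RGet ''v'' (Const 0))) copy_com)
       Skip)))"

definition power_body :: com where
  "power_body = Seq (Incr ''t'') (Seq (Assign ''s'' (Const 0)) (Seq (Assign ''j'' (Const 0)) (Seq
     (While (ILess (Var ''j'') (Var ''B''))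
       (Seq (Assign ''s'' (IPlus (Var ''s'') (Var ''P''))) (Incr ''j'')))
     (Assign ''P'' (Var ''s'')))))"

definition search_com :: com where
  "search_com =
     Seq (Assign ''B'' (IPlus (scaled 10 (Var ''k'')) (Const 1))) (Seq (Assign ''P'' (Const 1)) (Seq
       (While (ILess (Var ''t'') (Var ''k'')) power_body)
       (While (ILess (Var ''N'') (Var ''P'')) try_com)))"

lemma written_scan [simp]:
  "iwritten scan_body = {''i'', ''a'', ''x''}" "rwritten scan_body = {''v'', ''w''}"
  "iwritten scan_com = {''i'', ''a'', ''x''}" "rwritten scan_com = {''v'', ''w''}"
  by (auto simp: scan_body_def scan_com_def)

lemma written_round [simp]:
  "iwritten rank_body = {''i'', ''a'', ''x'', ''mark'', ''j''}" "rwritten rank_body = {''v'', ''w''}"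
  "iwritten rank_com = {''i'', ''a'', ''x'', ''mark'', ''j''}" "rwritten rank_com = {''v'', ''w''}"
  "iwritten mark_com = {''i'', ''mark''}" "rwritten mark_com = {}"
  "iwritten digit_com = {''c'', ''q''}" "rwritten digit_com = {}"
  "iwritten round_com = {''i'', ''a'', ''x'', ''mark'', ''j'', ''c'', ''q'', ''t'', ''m''}"
  "rwritten round_com = {''v'', ''w''}"
  by (auto simp: rank_body_def rank_com_def mark_com_def digit_com_def round_com_def)

lemma written_try [simp]:
  "iwritten climb_com = {''i'', ''a'', ''x'', ''mark'', ''j'', ''c'', ''q'', ''t'', ''m''}"
  "rwritten climb_com = {''v'', ''w''}"
  "iwritten copy_com = {''len'', ''i'', ''out''}" "rwritten copy_com = {}"
  "iwritten try_com =
     {''i'', ''a'', ''x'', ''mark'', ''j'', ''c'', ''q'', ''t'', ''m'', ''len'', ''out'', ''N''}"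
  "rwritten try_com = {''v'', ''w'', ''best''}"
  "iwritten power_body = {''t'', ''s'', ''j'', ''P''}" "rwritten power_body = {}"
  by (auto simp: climb_com_def copy_com_def try_com_def power_body_def)

lemma image_cong_lessThan:
  assumes "\<forall>l<m. a' l = a l"
  shows "a' ` {..<m::nat} = a ` {..<m}"
  using assms by (intro image_cong) auto

lemma reaches_scan:
  assumes n: "I ''n'' 0 = n" and U: "\<forall>i<n. I ''mark'' i \<noteq> 0 \<longleftrightarrow> i \<in> U"
    and m: "I ''m'' 0 = m" and A: "I ''a'' ` {..<m} = A"
  shows "reaches h scan_com I R
    (\<lambda>I' R'. I' ''x'' 0 = scan h n U A n \<and> (\<forall>l<m. I' ''a'' l = I ''a'' l)) (3 + 8 * n)"
proof -
  define Inv where "Inv i I' R' \<longleftrightarrow> I' ''i'' 0 = i \<and> I' ''x'' 0 = scan h n U A i \<and>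
      (scan h n U A i < n \<longrightarrow> R' ''w'' 0 = h (insert (scan h n U A i) A)) \<and>
      (\<forall>l<m. I' ''a'' l = I ''a'' l)"
    for i and I' :: imem and R' :: rmem
  have loop: "reaches h (While (ILess (Var ''i'') (Var ''n'')) scan_body) I1 R1 (Inv n) (1 + n * (7 + 1))"
    if I1: "Inv 0 I1 R1" "I1 ''n'' = I ''n''" "I1 ''m'' = I ''m''" "I1 ''mark'' = I ''mark''" for I1 R1
  proof (rule reaches_While)
    fix i I' R'
    assume i: "i < n" and inv: "Inv i I' R'" and "unchanged scan_body I1 R1 I' R'"
    note frame = unchangedD[OF this(3)]
    have [simp]: "I' ''n'' 0 = n" "I' ''m'' 0 = m" "I' ''mark'' = I ''mark''" "I' ''i'' 0 = i"
      "I' ''x'' 0 = scan h n U A i"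
      using frame(1)[of "''n''"] frame(1)[of "''m''"] frame(1)[of "''mark''"] inv I1 n m
      by (simp_all add: Inv_def)
    have img: "(I' ''a'')(m := i) ` {..<Suc m} = insert i A"
    proof -
      have "(I' ''a'')(m := i) ` {..<m} = A"
        using inv image_cong_lessThan[of m "(I' ''a'')(m := i)" "I ''a''"] A by (simp add: Inv_def)
      then show ?thesis by (simp only: lessThan_Suc image_insert fun_upd_same)
    qed
    have "reaches h scan_body I' R' (Inv (Suc i)) 7"
      unfolding scan_body_def
      using i inv U img
      by (intro reaches_straight) (auto simp: Inv_def)
    then show "bval (ILess (Var ''i'') (Var ''n'')) (mem I' R' 0 0) \<and>
        reaches h scan_body I' R' (Inv (Suc i)) 7"
      using i by simp
  next
    fix I' R'
    assume inv: "Inv n I' R'" and "unchanged scan_body I1 R1 I' R'"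
    then show "\<not> bval (ILess (Var ''i'') (Var ''n'')) (mem I' R' 0 0)"
      using n that unchangedD(1)[of scan_body I1 R1 I' R' "''n''"] by (simp add: Inv_def)
  qed (use that in simp)
  show ?thesis
  proof (rule reaches_mono)
    show "reaches h scan_com I R (Inv n) (1 + (1 + (1 + n * (7 + 1))))"
      unfolding scan_com_def by (intro reaches_ISet_Seq loop) (simp_all add: Inv_def n)
  qed (simp_all add: Inv_def)
qed

lemma reaches_rank:
  assumes n: "I ''n'' 0 = n" and A: "I ''a'' ` {..<m} = A" "I ''m'' 0 = m"
    and c: "I ''c'' 0 = c" and mark: "\<forall>i<n. I ''mark'' i \<noteq> 0 \<longleftrightarrow> i \<in> A"
  shows "reaches h rank_com I R
    (\<lambda>I' R'. I' ''x'' 0 = ranked h n A c \<and> (\<forall>l<m. I' ''a'' l = I ''a'' l)) (3 + c * (8 * n + 6))"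
proof -
  define Inv where "Inv j I' R' \<longleftrightarrow> I' ''j'' 0 = j \<and> I' ''x'' 0 = ranked h n A j \<and>
      (\<forall>i<n. I' ''mark'' i \<noteq> 0 \<longleftrightarrow> i \<in> marked h n A j) \<and> (\<forall>l<m. I' ''a'' l = I ''a'' l)"
    for j and I' :: imem and R' :: rmem
  have loop: "reaches h (While (ILess (Var ''j'') (Var ''c'')) rank_body) I1 R1 (Inv c)
      (1 + c * (8 * n + 5 + 1))"
    if I1: "Inv 0 I1 R1" "I1 ''n'' = I ''n''" "I1 ''m'' = I ''m''" "I1 ''c'' = I ''c''" for I1 R1
  proof (rule reaches_While)
    fix j I' R'
    assume j: "j < c" and inv: "Inv j I' R'" and "unchanged rank_body I1 R1 I' R'"
    note frame = unchangedD[OF this(3)]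
    have I': "I' ''n'' 0 = n" "I' ''m'' 0 = m" "I' ''c'' 0 = c" "I' ''j'' 0 = j"
      using frame(1)[of "''n''"] frame(1)[of "''m''"] frame(1)[of "''c''"] inv I1 n A c
      by (simp_all add: Inv_def)
    have "I' ''a'' ` {..<m} = A"
      using inv image_cong_lessThan[of m "I' ''a''" "I ''a''"] A by (simp add: Inv_def)
    then have scan: "reaches h scan_com I' R' (\<lambda>I2 R2. I2 ''x'' 0 = scan h n (marked h n A j) A n \<and>
        (\<forall>l<m. I2 ''a'' l = I' ''a'' l)) (3 + 8 * n)"
      using inv I' by (intro reaches_scan) (auto simp: Inv_def)
    have "reaches h rank_body I' R' (Inv (Suc j)) (3 + 8 * n + 2)"
      unfolding rank_body_def
    proof (rule reaches_Seq[OF scan])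
      fix I2 R2
      assume I2: "I2 ''x'' 0 = scan h n (marked h n A j) A n \<and> (\<forall>l<m. I2 ''a'' l = I' ''a'' l)"
        and "unchanged scan_com I' R' I2 R2"
      note frame = unchangedD(1)[OF this(2)]
      have "I2 ''mark'' = I' ''mark''" "I2 ''j'' = I' ''j''"
        using frame by simp_all
      then show "reaches h (Seq (ISet ''mark'' (Var ''x'') (Const 1)) (Incr ''j'')) I2 R2 (Inv (Suc j)) 2"
        using I2 inv I' by (intro reaches_straight) (auto simp: Inv_def ranked_def)
    qed
    then show "bval (ILess (Var ''j'') (Var ''c'')) (mem I' R' 0 0) \<and>
        reaches h rank_body I' R' (Inv (Suc j)) (8 * n + 5)"
      using I' j by (auto elim: reaches_cost)
  next
    fix I' R'
    assume inv: "Inv c I' R'" and "unchanged rank_body I1 R1 I' R'"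
    then show "\<not> bval (ILess (Var ''j'') (Var ''c'')) (mem I' R' 0 0)"
      using c that unchangedD(1)[of rank_body I1 R1 I' R' "''c''"] by (simp add: Inv_def)
  qed (use that in simp)
  show ?thesis
  proof (rule reaches_mono)
    show "reaches h rank_com I R (Inv c) (1 + (1 + (1 + c * (8 * n + 5 + 1))))"
      unfolding rank_com_def
      by (intro reaches_ISet_Seq loop) (use mark in \<open>simp_all add: Inv_def n ranked_def\<close>)
    show "1 + (1 + (1 + c * (8 * n + 5 + 1))) \<le> 3 + c * (8 * n + 6)"
      by simp
  qed (simp add: Inv_def)
qed

lemma reaches_mark:
  assumes n: "I ''n'' 0 = n" and A: "I ''a'' ` {..<m} = A" "I ''m'' 0 = m"
  shows "reaches h mark_com I R
    (\<lambda>I' R'. \<forall>i<n. I' ''mark'' i \<noteq> 0 \<longleftrightarrow> i \<in> A) (4 + 3 * n + 3 * m)"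
proof -
  define Inv1 where "Inv1 i I' R' \<longleftrightarrow> I' ''i'' 0 = i \<and> (\<forall>l<i. I' ''mark'' l = 0)"
    for i and I' :: imem and R' :: rmem
  define Inv2 where "Inv2 i I' R' \<longleftrightarrow> I' ''i'' 0 = i \<and>
      (\<forall>l<n. I' ''mark'' l \<noteq> 0 \<longleftrightarrow> l \<in> I ''a'' ` {..<i})"
    for i and I' :: imem and R' :: rmem
  let ?c1 = "Seq (ISet ''mark'' (Var ''i'') (Const 0)) (Incr ''i'')"
  let ?c2 = "Seq (ISet ''mark'' (IGet ''a'' (Var ''i'')) (Const 1)) (Incr ''i'')"
  have loop1: "reaches h (While (ILess (Var ''i'') (Var ''n'')) ?c1) I1 R1 (Inv1 n) (1 + n * (2 + 1))"
    if "Inv1 0 I1 R1" "I1 ''n'' = I ''n''" for I1 R1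
  proof (rule reaches_While)
    fix i I' R'
    assume i: "i < n" "Inv1 i I' R'" "unchanged ?c1 I1 R1 I' R'"
    have "I' ''n'' 0 = n" using unchangedD(1)[OF i(3), of "''n''"] that n by simp
    moreover have "reaches h ?c1 I' R' (Inv1 (Suc i)) 2"
      using i(1,2) by (intro reaches_straight) (auto simp: Inv1_def)
    ultimately show "bval (ILess (Var ''i'') (Var ''n'')) (mem I' R' 0 0) \<and>
        reaches h ?c1 I' R' (Inv1 (Suc i)) 2"
      using i by (simp add: Inv1_def)
  next
    fix I' R'
    assume "Inv1 n I' R'" "unchanged ?c1 I1 R1 I' R'"
    then show "\<not> bval (ILess (Var ''i'') (Var ''n'')) (mem I' R' 0 0)"
      using unchangedD(1)[of ?c1 I1 R1 I' R' "''n''"] that n by (simp add: Inv1_def)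
  qed (use that in simp)
  have loop2: "reaches h (While (ILess (Var ''i'') (Var ''m'')) ?c2) I1 R1 (Inv2 m) (1 + m * (2 + 1))"
    if "Inv2 0 I1 R1" "I1 ''m'' = I ''m''" "I1 ''a'' = I ''a''" for I1 R1
  proof (rule reaches_While)
    fix i I' R'
    assume i: "i < m" "Inv2 i I' R'" "unchanged ?c2 I1 R1 I' R'"
    have I': "I' ''m'' 0 = m" "I' ''a'' = I ''a''"
      using unchangedD(1)[OF i(3), of "''m''"] unchangedD(1)[OF i(3), of "''a''"] that A by simp_all
    moreover have "reaches h ?c2 I' R' (Inv2 (Suc i)) 2"
      using i(1,2) I' by (intro reaches_straight) (auto simp: Inv2_def lessThan_Suc)
    ultimately show "bval (ILess (Var ''i'') (Var ''m'')) (mem I' R' 0 0) \<and>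
        reaches h ?c2 I' R' (Inv2 (Suc i)) 2"
      using i by (simp add: Inv2_def)
  next
    fix I' R'
    assume "Inv2 m I' R'" "unchanged ?c2 I1 R1 I' R'"
    then show "\<not> bval (ILess (Var ''i'') (Var ''m'')) (mem I' R' 0 0)"
      using unchangedD(1)[of ?c2 I1 R1 I' R' "''m''"] that A by (simp add: Inv2_def)
  qed (use that in simp)
  show ?thesis
    unfolding mark_com_def
  proof (rule reaches_cost)
    show "reaches h (Seq (Assign ''i'' (Const 0)) (Seq
       (While (ILess (Var ''i'') (Var ''n'')) ?c1) (Seq (Assign ''i'' (Const 0))
       (While (ILess (Var ''i'') (Var ''m'')) ?c2)))) I R
       (\<lambda>I' R'. \<forall>i<n. I' ''mark'' i \<noteq> 0 \<longleftrightarrow> i \<in> A)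
       (1 + (1 + n * (2 + 1) + (1 + (1 + m * (2 + 1)))))"
    proof (rule reaches_ISet_Seq, rule reaches_Seq[OF loop1], goal_cases)
      case (3 I1 R1)
      note frame = unchangedD(1)[OF 3(2)]
      have "I1 ''m'' = I ''m''" "I1 ''a'' = I ''a''"
        using frame[of "''m''"] frame[of "''a''"] by simp_all
      then show ?case
        using 3(1) A
        by (intro reaches_ISet_Seq, intro reaches_mono[OF loop2]) (auto simp: Inv1_def Inv2_def)
    qed (auto simp: Inv1_def)
  qed simp
qed

lemma reaches_digit:
  assumes q: "I ''q'' 0 = q" and B: "I ''B'' 0 = B" "B > 0"
  shows "reaches h digit_com I R
    (\<lambda>I' R'. I' ''c'' 0 = q mod B \<and> I' ''q'' 0 = q div B) (3 + 3 * q)"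
proof -
  define Inv where "Inv i I' R' \<longleftrightarrow> I' ''q'' 0 = i \<and> I' ''c'' 0 = q - i * B"
    for i and I' :: imem and R' :: rmem
  let ?c = "Seq (Assign ''c'' (IMinus (Var ''c'') (Var ''B''))) (Incr ''q'')"
  let ?b = "BNot (ILess (Var ''c'') (Var ''B''))"
  have loop: "reaches h (While ?b ?c) I1 R1 (Inv (q div B)) (1 + (q div B) * (2 + 1))"
    if "Inv 0 I1 R1" "I1 ''B'' = I ''B''" for I1 R1
  proof (rule reaches_While)
    fix i I' R'
    assume i: "i < q div B" "Inv i I' R'" "unchanged ?c I1 R1 I' R'"
    have I': "I' ''B'' 0 = B" using unchangedD(1)[OF i(3), of "''B''"] that B by simp
    have "Suc i * B \<le> q"
      using i(1) B(2) by (metis Suc_leI less_eq_div_iff_mult_less_eq)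
    then have "\<not> q - i * B < B" by simp
    moreover have "reaches h ?c I' R' (Inv (Suc i)) 2"
      using i(2) I' by (intro reaches_straight) (auto simp: Inv_def)
    ultimately show "bval ?b (mem I' R' 0 0) \<and> reaches h ?c I' R' (Inv (Suc i)) 2"
      using i(2) I' by (simp add: Inv_def)
  next
    fix I' R'
    assume "Inv (q div B) I' R'" "unchanged ?c I1 R1 I' R'"
    then show "\<not> bval ?b (mem I' R' 0 0)"
      using unchangedD(1)[of ?c I1 R1 I' R' "''B''"] that B
      by (simp add: Inv_def minus_div_mult_eq_mod)
  qed (use that in simp)
  have cost_le: "1 + (1 + (1 + d * (2 + 1))) \<le> 3 + 3 * q" if "d \<le> q" for d :: nat
    using that by simp
  show ?thesis
  proof (rule reaches_mono)
    show "reaches h digit_com I R (Inv (q div B)) (1 + (1 + (1 + (q div B) * (2 + 1))))"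
      unfolding digit_com_def by (intro reaches_ISet_Seq loop) (simp_all add: Inv_def q)
    show "1 + (1 + (1 + (q div B) * (2 + 1))) \<le> 3 + 3 * q"
      using cost_le[OF div_le_dividend] .
  qed (simp add: Inv_def minus_div_mult_eq_mod)
qed

lemma reaches_round:
  assumes env: "I ''n'' 0 = n" "I ''B'' 0 = B" "B > 0"
    and q: "I ''q'' 0 = q" and A: "I ''a'' ` {..<m} = A" "I ''m'' 0 = m"
  shows "reaches h round_com I R
    (\<lambda>I' R'. I' ''q'' 0 = q div B \<and> I' ''t'' 0 = Suc (I ''t'' 0) \<and> I' ''m'' 0 \<le> Suc m \<and>
       I' ''a'' ` {..<I' ''m'' 0} = extend h n A (q mod B))
    (14 + 3 * q + 3 * n + 3 * m + B * (8 * n + 6))"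
proof -
  let ?c = "q mod B"
  let ?last = "Seq (Incr ''t'') (If (ILess (Var ''x'') (Var ''n''))
    (Seq (ISet ''a'' (Var ''m'') (Var ''x'')) (Incr ''m'')) Skip)"
  let ?Q = "\<lambda>I' R'. I' ''q'' 0 = q div B \<and> I' ''t'' 0 = Suc (I ''t'' 0) \<and> I' ''m'' 0 \<le> Suc m \<and>
       I' ''a'' ` {..<I' ''m'' 0} = extend h n A ?c"
  have main: "reaches h round_com I R ?Q
    (3 + 3 * q + (4 + 3 * n + 3 * m + (3 + ?c * (8 * n + 6) + 4)))"
    unfolding round_com_def
  proof (rule reaches_Seq[OF reaches_digit[where q = q and B = B]])
    fix I1 R1
    assume 1: "I1 ''c'' 0 = ?c \<and> I1 ''q'' 0 = q div B" "unchanged digit_com I R I1 R1"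
    note frame = unchangedD(1)[OF 1(2)]
    have I1: "I1 ''n'' = I ''n''" "I1 ''a'' = I ''a''" "I1 ''m'' = I ''m''" "I1 ''t'' = I ''t''"
      using frame by simp_all
    show "reaches h (Seq mark_com (Seq rank_com ?last)) I1 R1 ?Q
      (4 + 3 * n + 3 * m + (3 + ?c * (8 * n + 6) + 4))"
    proof (rule reaches_Seq[OF reaches_mark[where n = n and m = m and A = A]])
      fix I2 R2
      assume 2: "\<forall>i<n. I2 ''mark'' i \<noteq> 0 \<longleftrightarrow> i \<in> A" "unchanged mark_com I1 R1 I2 R2"
      note frame = unchangedD(1)[OF 2(2)]
      have I2: "I2 ''n'' = I1 ''n''" "I2 ''a'' = I1 ''a''" "I2 ''m'' = I1 ''m''"
        "I2 ''t'' = I1 ''t''" "I2 ''c'' = I1 ''c''" "I2 ''q'' = I1 ''q''"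
        using frame by simp_all
      show "reaches h (Seq rank_com ?last) I2 R2 ?Q (3 + ?c * (8 * n + 6) + 4)"
      proof (rule reaches_Seq[OF reaches_rank[where n = n and m = m and A = A and c = ?c]])
        fix I3 R3
        assume 3: "I3 ''x'' 0 = ranked h n A ?c \<and> (\<forall>l<m. I3 ''a'' l = I2 ''a'' l)"
          "unchanged rank_com I2 R2 I3 R3"
        note frame = unchangedD(1)[OF 3(2)]
        have I3: "I3 ''n'' = I2 ''n''" "I3 ''m'' = I2 ''m''" "I3 ''t'' = I2 ''t''" "I3 ''q'' = I2 ''q''"
          using frame by simp_all
        have a: "I3 ''a'' ` {..<m} = A"
          using image_cong_lessThan[of m "I3 ''a''" "I ''a''"] 3(1) I1 I2 A by simp
        moreover have "(I3 ''a'')(m := v) ` {..<Suc m} = insert v A" for v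
        proof -
          have "(I3 ''a'')(m := v) ` {..<m} = A"
            using a image_cong_lessThan[of m "(I3 ''a'')(m := v)" "I3 ''a''"] by simp
          then show ?thesis by (simp only: lessThan_Suc image_insert fun_upd_same)
        qed
        ultimately show "reaches h ?last I3 R3 ?Q 4"
          using 1(1) 3(1) I1 I2 I3 A env by (intro reaches_straight) (auto simp: extend_def)
      qed (use 1(1) 2(1) I1 I2 A env in simp_all)
    qed (use I1 A env in simp_all)
  qed (use env q in simp_all)
  have "?c * (8 * n + 6) \<le> B * (8 * n + 6)"
    using env(3) by (intro mult_le_mono1) simp
  then show ?thesis
    by (intro reaches_cost[OF main]) simp
qed

definition climb_cost :: "nat \<Rightarrow> nat \<Rightarrow> nat \<Rightarrow> nat \<Rightarrow> nat" where
  "climb_cost n k B N = 4 + k * (15 + 3 * N + 3 * n + 3 * k + B * (8 * n + 6))"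

lemma reaches_climb:
  assumes env: "I ''n'' 0 = n" "I ''k'' 0 = k" "I ''B'' 0 = B" "B > 0" and N: "I ''N'' 0 = N"
  shows "reaches h climb_com I R
    (\<lambda>I' R'. I' ''m'' 0 \<le> k \<and> I' ''a'' ` {..<I' ''m'' 0} = climb h n B k {} N) (climb_cost n k B N)"
proof -
  define Inv where "Inv t I' R' \<longleftrightarrow> I' ''t'' 0 = t \<and> I' ''m'' 0 \<le> t \<and> I' ''q'' 0 \<le> N \<and>
      climb h n B (k - t) (I' ''a'' ` {..<I' ''m'' 0}) (I' ''q'' 0) = climb h n B k {} N"
    for t and I' :: imem and R' :: rmem
  let ?T = "14 + 3 * N + 3 * n + 3 * k + B * (8 * n + 6)"
  have loop: "reaches h (While (ILess (Var ''t'') (Var ''k'')) round_com) I1 R1 (Inv k) (1 + k * (?T + 1))"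
    if "Inv 0 I1 R1" "I1 ''n'' = I ''n''" "I1 ''k'' = I ''k''" "I1 ''B'' = I ''B''" for I1 R1
  proof (rule reaches_While)
    fix t I' R'
    assume t: "t < k" and inv: "Inv t I' R'" and "unchanged round_com I1 R1 I' R'"
    note frame = unchangedD(1)[OF this(3)]
    have I': "I' ''n'' 0 = n" "I' ''k'' 0 = k" "I' ''B'' 0 = B"
      using frame[of "''n''"] frame[of "''k''"] frame[of "''B''"] env that by simp_all
    obtain r where r: "k - t = Suc r" "k - Suc t = r"
      using t by (metis Suc_diff_Suc)
    have "reaches h round_com I' R' (Inv (Suc t)) ?T"
      using inv I' env(4) t r
        order_trans[OF div_le_dividend[of "I' ''q'' 0" B], of N]
      by (intro reaches_mono[OF reaches_round[where n = n and B = B and A = "I' ''a'' ` {..<I' ''m'' 0}"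
              and m = "I' ''m'' 0" and q = "I' ''q'' 0"]])
        (auto simp: Inv_def)
    then show "bval (ILess (Var ''t'') (Var ''k'')) (mem I' R' 0 0) \<and>
        reaches h round_com I' R' (Inv (Suc t)) ?T"
      using t I' inv by (simp add: Inv_def)
  next
    fix I' R'
    assume "Inv k I' R'" "unchanged round_com I1 R1 I' R'"
    then show "\<not> bval (ILess (Var ''t'') (Var ''k'')) (mem I' R' 0 0)"
      using env that unchangedD(1)[of round_com I1 R1 I' R' "''k''"] by (simp add: Inv_def)
  qed (use that in simp)
  show ?thesis
  proof (rule reaches_mono)
    show "reaches h climb_com I R (Inv k) (1 + (1 + (1 + (1 + k * (?T + 1)))))"
      unfolding climb_com_def by (intro reaches_ISet_Seq loop) (simp_all add: Inv_def N)
    show "1 + (1 + (1 + (1 + k * (?T + 1)))) \<le> climb_cost n k B N"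
      by (simp add: climb_cost_def)
  qed (simp add: Inv_def)
qed

lemma reaches_copy:
  assumes m: "I ''m'' 0 = m"
  shows "reaches h copy_com I R
    (\<lambda>I' R'. I' ''len'' 0 = m \<and> (\<forall>l<m. I' ''out'' l = I ''a'' l)) (3 + 3 * m)"
proof -
  define Inv where "Inv i I' R' \<longleftrightarrow> I' ''i'' 0 = i \<and> I' ''len'' 0 = m \<and> (\<forall>l<i. I' ''out'' l = I ''a'' l)"
    for i and I' :: imem and R' :: rmem
  let ?c = "Seq (ISet ''out'' (Var ''i'') (IGet ''a'' (Var ''i''))) (Incr ''i'')"
  have loop: "reaches h (While (ILess (Var ''i'') (Var ''m'')) ?c) I1 R1 (Inv m) (1 + m * (2 + 1))"
    if "Inv 0 I1 R1" "I1 ''m'' = I ''m''" "I1 ''a'' = I ''a''" for I1 R1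
  proof (rule reaches_While)
    fix i I' R'
    assume i: "i < m" "Inv i I' R'" "unchanged ?c I1 R1 I' R'"
    have I': "I' ''m'' 0 = m" "I' ''a'' = I ''a''"
      using unchangedD(1)[OF i(3), of "''m''"] unchangedD(1)[OF i(3), of "''a''"] that m by simp_all
    have "reaches h ?c I' R' (Inv (Suc i)) 2"
      using i(2) I' by (intro reaches_straight) (auto simp: Inv_def less_Suc_eq)
    then show "bval (ILess (Var ''i'') (Var ''m'')) (mem I' R' 0 0) \<and> reaches h ?c I' R' (Inv (Suc i)) 2"
      using i I' by (simp add: Inv_def)
  next
    fix I' R'
    assume "Inv m I' R'" "unchanged ?c I1 R1 I' R'"
    then show "\<not> bval (ILess (Var ''i'') (Var ''m'')) (mem I' R' 0 0)"
      using m that unchangedD(1)[of ?c I1 R1 I' R' "''m''"] by (simp add: Inv_def)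
  qed (use that in simp)
  show ?thesis
  proof (rule reaches_mono)
    show "reaches h copy_com I R (Inv m) (1 + (1 + (1 + m * (2 + 1))))"
      unfolding copy_com_def by (intro reaches_ISet_Seq loop) (simp_all add: Inv_def m)
  qed (simp_all add: Inv_def)
qed

lemma climb_subset: "A \<subseteq> {..<n} \<Longrightarrow> climb h n B r A q \<subseteq> {..<n}"
  by (induction r arbitrary: A q) (auto simp: extend_def)

definition best_so_far ::
  "(nat set \<Rightarrow> real) \<Rightarrow> nat \<Rightarrow> nat \<Rightarrow> nat \<Rightarrow> nat \<Rightarrow> imem \<Rightarrow> rmem \<Rightarrow> bool" where
  "best_so_far h n k B N I R \<longleftrightarrow> I ''N'' 0 = N \<and> I ''len'' 0 \<le> k \<and>
     I ''out'' ` {..<I ''len'' 0} \<subseteq> {..<n} \<and> R ''best'' 0 \<le> h (I ''out'' ` {..<I ''len'' 0}) \<and>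
     (\<forall>q<N. h (climb h n B k {} q) \<le> R ''best'' 0)"

lemma reaches_try:
  assumes env: "I ''n'' 0 = n" "I ''k'' 0 = k" "I ''B'' 0 = B" "B > 0"
    and inv: "best_so_far h n k B N I R"
  shows "reaches h try_com I R (best_so_far h n k B (Suc N)) (climb_cost n k B N + (7 + 3 * k))"
  unfolding try_com_def
proof (rule reaches_Seq[OF reaches_climb[where n = n and k = k and B = B and N = N]])
  fix I1 R1
  let ?X = "climb h n B k {} N"
  assume 1: "I1 ''m'' 0 \<le> k \<and> I1 ''a'' ` {..<I1 ''m'' 0} = ?X" "unchanged climb_com I R I1 R1"
  let ?m = "I1 ''m'' 0"
  have I1: "I1 ''N'' = I ''N''" "I1 ''len'' = I ''len''" "I1 ''out'' = I ''out''" "R1 ''best'' = R ''best''"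
    using unchangedD(1)[OF 1(2)] unchangedD(2)[OF 1(2)] by simp_all
  define I2 where "I2 = I1(''N'' := (I1 ''N'')(0 := Suc N))"
  define R2 where "R2 = R1(''v'' := (R1 ''v'')(0 := h ?X))"
  have "reaches h (If (RLess (RGet ''best'' (Const 0)) (RGet ''v'' (Const 0)))
       (Seq (RSet ''best'' (Const 0) (RGet ''v'' (Const 0))) copy_com) Skip) I2 R2
     (best_so_far h n k B (Suc N)) (Suc (4 + 3 * k))"
  proof (rule reaches_If)
    assume "bval (RLess (RGet ''best'' (Const 0)) (RGet ''v'' (Const 0))) (mem I2 R2 0 0)"
    then have better: "R ''best'' 0 < h ?X"
      using I1 by (simp add: R2_def)
    have "reaches h (Seq (RSet ''best'' (Const 0) (RGet ''v'' (Const 0))) copy_com) I2 R2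
      (best_so_far h n k B (Suc N)) (1 + (3 + 3 * ?m))"
    proof (rule reaches_Seq[where Q = "\<lambda>I' R'. I' = I2 \<and> R' = R2(''best'' := (R2 ''best'')(0 := h ?X))"])
      fix I3 R3
      assume "I3 = I2 \<and> R3 = R2(''best'' := (R2 ''best'')(0 := h ?X))"
      then have I3: "I3 = I2" "R3 ''best'' 0 = h ?X" by simp_all
      have "reaches h copy_com I3 R3
         (\<lambda>I' R'. I' ''len'' 0 = ?m \<and> (\<forall>l<?m. I' ''out'' l = I3 ''a'' l)) (3 + 3 * ?m)"
        using I3 by (intro reaches_copy) (simp add: I2_def)
      then show "reaches h copy_com I3 R3 (best_so_far h n k B (Suc N)) (3 + 3 * ?m)"
      proof (rule reaches_mono)
        fix I4 R4
        assume 4: "I4 ''len'' 0 = ?m \<and> (\<forall>l<?m. I4 ''out'' l = I3 ''a'' l)"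
          "unchanged copy_com I3 R3 I4 R4"
        have "I4 ''N'' 0 = Suc N" "R4 ''best'' 0 = h ?X"
          using unchangedD(1)[OF 4(2), of "''N''"] unchangedD(2)[OF 4(2), of "''best''"] I3
          by (simp_all add: I2_def)
        moreover have "I4 ''out'' ` {..<I4 ''len'' 0} = ?X"
          using image_cong_lessThan[of ?m "I4 ''out''" "I1 ''a''"] 4(1) I3 1(1) by (simp add: I2_def)
        ultimately show "best_so_far h n k B (Suc N) I4 R4"
          using 4(1) 1(1) inv better climb_subset[of "{}" n h B k N]
          by (force simp: best_so_far_def less_Suc_eq)
      qed simp
    qed (intro reaches_straight; simp add: R2_def)
    then show "reaches h (Seq (RSet ''best'' (Const 0) (RGet ''v'' (Const 0))) copy_com) I2 R2
      (best_so_far h n k B (Suc N)) (4 + 3 * k)"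
      using 1(1) by (auto elim: reaches_cost)
  next
    assume "\<not> bval (RLess (RGet ''best'' (Const 0)) (RGet ''v'' (Const 0))) (mem I2 R2 0 0)"
    then have "h ?X \<le> R ''best'' 0"
      using I1 by (simp add: R2_def)
    then have "best_so_far h n k B (Suc N) I2 R2"
      using inv I1 by (auto simp: best_so_far_def I2_def R2_def less_Suc_eq)
    then show "reaches h Skip I2 R2 (best_so_far h n k B (Suc N)) (4 + 3 * k)"
      by (intro reaches_straight) auto
  qed
  moreover have "I1 ''N'' 0 = N"
    using inv I1 by (simp add: best_so_far_def)
  ultimately have "reaches h (Seq (Query ''v'' (Const 0) ''a'' (Var ''m'')) (Seq (Incr ''N'')
     (If (RLess (RGet ''best'' (Const 0)) (RGet ''v'' (Const 0)))
       (Seq (RSet ''best'' (Const 0) (RGet ''v'' (Const 0))) copy_com)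
       Skip))) I1 R1 (best_so_far h n k B (Suc N)) (1 + (1 + Suc (4 + 3 * k)))"
    using 1(1)
    by (intro reaches_Seq[where c = "Query _ _ _ _" and Q = "\<lambda>I' R'. I' = I1 \<and> R' = R2"] reaches_Query
          reaches_Seq[where c = "ISet _ _ _" and Q = "\<lambda>I' R'. I' = I2 \<and> R' = R2"] reaches_ISet)
      (auto simp: I2_def R2_def)
  then show "reaches h (Seq (Query ''v'' (Const 0) ''a'' (Var ''m'')) (Seq (Incr ''N'')
     (If (RLess (RGet ''best'' (Const 0)) (RGet ''v'' (Const 0)))
       (Seq (RSet ''best'' (Const 0) (RGet ''v'' (Const 0))) copy_com)
       Skip))) I1 R1 (best_so_far h n k B (Suc N)) (7 + 3 * k)"
    by (rule reaches_cost) simp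
qed (use env inv in \<open>auto simp: best_so_far_def\<close>)

lemma reaches_power_body:
  assumes B: "I ''B'' 0 = B"
  shows "reaches h power_body I R
    (\<lambda>I' R'. I' ''t'' 0 = Suc (I ''t'' 0) \<and> I' ''P'' 0 = B * I ''P'' 0) (5 + 3 * B)"
proof -
  define Inv where "Inv j I' R' \<longleftrightarrow> I' ''j'' 0 = j \<and> I' ''s'' 0 = j * I ''P'' 0"
    for j and I' :: imem and R' :: rmem
  let ?c = "Seq (Assign ''s'' (IPlus (Var ''s'') (Var ''P''))) (Incr ''j'')"
  let ?b = "ILess (Var ''j'') (Var ''B'')"
  have loop: "reaches h (While ?b ?c) I1 R1 (Inv B) (1 + B * (2 + 1))"
    if "Inv 0 I1 R1" "I1 ''B'' = I ''B''" "I1 ''P'' = I ''P''" for I1 R1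
  proof (rule reaches_While)
    fix j I' R'
    assume j: "j < B" "Inv j I' R'" "unchanged ?c I1 R1 I' R'"
    have I': "I' ''B'' 0 = B" "I' ''P'' = I ''P''"
      using unchangedD(1)[OF j(3), of "''B''"] unchangedD(1)[OF j(3), of "''P''"] that B by simp_all
    have "reaches h ?c I' R' (Inv (Suc j)) 2"
      using j(2) I' by (intro reaches_straight) (auto simp: Inv_def)
    then show "bval ?b (mem I' R' 0 0) \<and> reaches h ?c I' R' (Inv (Suc j)) 2"
      using j I' by (simp add: Inv_def)
  next
    fix I' R'
    assume "Inv B I' R'" "unchanged ?c I1 R1 I' R'"
    then show "\<not> bval ?b (mem I' R' 0 0)"
      using B that unchangedD(1)[of ?c I1 R1 I' R' "''B''"] by (simp add: Inv_def)
  qed (use that in simp)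
  let ?I1 = "I(''t'' := (I ''t'')(0 := Suc (I ''t'' 0)), ''s'' := (I ''s'')(0 := 0), ''j'' := (I ''j'')(0 := 0))"
  have "reaches h (Seq (While ?b ?c) (Assign ''P'' (Var ''s''))) ?I1 R
      (\<lambda>I' R'. I' ''t'' 0 = Suc (I ''t'' 0) \<and> I' ''P'' 0 = B * I ''P'' 0) (1 + B * (2 + 1) + 1)"
  proof (rule reaches_Seq[OF loop])
    fix I2 R2
    assume 2: "Inv B I2 R2" "unchanged (While ?b ?c) ?I1 R I2 R2"
    have "I2 ''t'' 0 = Suc (I ''t'' 0)"
      using unchangedD(1)[OF 2(2), of "''t''"] by simp
    then show "reaches h (Assign ''P'' (Var ''s'')) I2 R2
      (\<lambda>I' R'. I' ''t'' 0 = Suc (I ''t'' 0) \<and> I' ''P'' 0 = B * I ''P'' 0) 1"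
      using 2(1) by (intro reaches_straight) (auto simp: Inv_def)
  qed (auto simp: Inv_def)
  then have "reaches h power_body I R
      (\<lambda>I' R'. I' ''t'' 0 = Suc (I ''t'' 0) \<and> I' ''P'' 0 = B * I ''P'' 0)
      (1 + (1 + (1 + (1 + B * (2 + 1) + 1))))"
    unfolding power_body_def by (intro reaches_ISet_Seq) simp
  then show ?thesis
    by (rule reaches_cost) simp
qed

definition search_cost :: "nat \<Rightarrow> nat \<Rightarrow> nat" where
  "search_cost n k = (let B = 10 * k + 1; P = B ^ k in
     4 + k * (6 + 3 * B) + P * (climb_cost n k B P + (8 + 3 * k)))"

lemma climb_cost_mono: "N \<le> N' \<Longrightarrow> climb_cost n k B N \<le> climb_cost n k B N'"
  unfolding climb_cost_def by (intro add_left_mono mult_left_mono add_mono) auto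

lemma reaches_search:
  assumes n: "I ''n'' 0 = n" and k: "I ''k'' 0 = k"
    and zero: "I ''t'' 0 = 0" "I ''N'' 0 = 0" "I ''len'' 0 = 0" "R ''best'' 0 = 0"
    and h: "0 \<le> h {}"
  shows "reaches h search_com I R (best_so_far h n k (10 * k + 1) ((10 * k + 1) ^ k)) (search_cost n k)"
proof -
  define B where "B = 10 * k + 1"
  define P where "P = B ^ k"
  define Inv where "Inv t I' R' \<longleftrightarrow> I' ''t'' 0 = t \<and> I' ''P'' 0 = B ^ t"
    for t and I' :: imem and R' :: rmem
  let ?b1 = "ILess (Var ''t'') (Var ''k'')" and ?b2 = "ILess (Var ''N'') (Var ''P'')"
  have power: "reaches h (While ?b1 power_body) I1 R1 (Inv k) (1 + k * (5 + 3 * B + 1))"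
    if "Inv 0 I1 R1" "I1 ''B'' 0 = B" "I1 ''k'' 0 = k" for I1 R1
  proof (rule reaches_While)
    fix t I' R'
    assume t: "t < k" "Inv t I' R'" "unchanged power_body I1 R1 I' R'"
    have I': "I' ''B'' 0 = B" "I' ''k'' 0 = k"
      using unchangedD(1)[OF t(3), of "''B''"] unchangedD(1)[OF t(3), of "''k''"] that by simp_all
    have "reaches h power_body I' R' (Inv (Suc t)) (5 + 3 * B)"
      using t(2) I' by (intro reaches_mono[OF reaches_power_body[where B = B]]) (auto simp: Inv_def)
    then show "bval ?b1 (mem I' R' 0 0) \<and> reaches h power_body I' R' (Inv (Suc t)) (5 + 3 * B)"
      using t I' by (simp add: Inv_def)
  next
    fix I' R'
    assume "Inv k I' R'" "unchanged power_body I1 R1 I' R'"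
    then show "\<not> bval ?b1 (mem I' R' 0 0)"
      using that unchangedD(1)[of power_body I1 R1 I' R' "''k''"] by (simp add: Inv_def)
  qed (use that in simp)
  let ?T = "climb_cost n k B P + (7 + 3 * k)"
  have tries: "reaches h (While ?b2 try_com) I1 R1 (best_so_far h n k B P) (1 + P * (?T + 1))"
    if "best_so_far h n k B 0 I1 R1" "I1 ''B'' 0 = B" "I1 ''k'' 0 = k" "I1 ''n'' 0 = n" "I1 ''P'' 0 = P"
    for I1 R1
  proof (rule reaches_While)
    fix N I' R'
    assume N: "N < P" "best_so_far h n k B N I' R'" "unchanged try_com I1 R1 I' R'"
    note frame = unchangedD(1)[OF N(3)]
    have I': "I' ''B'' 0 = B" "I' ''k'' 0 = k" "I' ''n'' 0 = n" "I' ''P'' 0 = P"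
      using frame[of "''B''"] frame[of "''k''"] frame[of "''n''"] frame[of "''P''"] that by simp_all
    have "reaches h try_com I' R' (best_so_far h n k B (Suc N)) ?T"
      using N I' climb_cost_mono[of N P n k B]
      by (intro reaches_cost[OF reaches_try[where N = N]]) (auto simp: B_def)
    then show "bval ?b2 (mem I' R' 0 0) \<and> reaches h try_com I' R' (best_so_far h n k B (Suc N)) ?T"
      using N I' by (simp add: best_so_far_def)
  next
    fix I' R'
    assume "best_so_far h n k B P I' R'" "unchanged try_com I1 R1 I' R'"
    then show "\<not> bval ?b2 (mem I' R' 0 0)"
      using that unchangedD(1)[of try_com I1 R1 I' R' "''P''"] by (simp add: best_so_far_def)
  qed (use that in simp)
  let ?I1 = "I(''B'' := (I ''B'')(0 := B), ''P'' := (I ''P'')(0 := 1))"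
  have "reaches h (Seq (While ?b1 power_body) (While ?b2 try_com)) ?I1 R (best_so_far h n k B P)
     (1 + k * (5 + 3 * B + 1) + (1 + P * (?T + 1)))"
  proof (rule reaches_Seq[OF power])
    fix I2 R2
    assume 2: "Inv k I2 R2" "unchanged (While ?b1 power_body) ?I1 R I2 R2"
    note frame = unchangedD(1)[OF 2(2)]
    have "I2 ''B'' 0 = B" "I2 ''k'' 0 = k" "I2 ''n'' 0 = n" "I2 ''N'' 0 = 0" "I2 ''len'' 0 = 0"
      "R2 ''best'' 0 = 0"
      using frame[of "''B''"] frame[of "''k''"] frame[of "''n''"] frame[of "''N''"] frame[of "''len''"]
        unchangedD(2)[OF 2(2), of "''best''"] n k zero by simp_all
    then show "reaches h (While ?b2 try_com) I2 R2 (best_so_far h n k B P) (1 + P * (?T + 1))"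
      using 2(1) h by (intro tries) (auto simp: best_so_far_def Inv_def P_def)
  qed (use k zero in \<open>auto simp: Inv_def\<close>)
  then have "reaches h search_com I R (best_so_far h n k B P)
     (1 + (1 + (1 + k * (5 + 3 * B + 1) + (1 + P * (?T + 1)))))"
    unfolding search_com_def by (intro reaches_ISet_Seq) (simp add: k B_def)
  then show ?thesis
    unfolding B_def[symmetric] P_def[symmetric]
    by (rule reaches_cost) (simp add: search_cost_def Let_def B_def P_def algebra_simps)
qed

lemma search_cost_le:
  assumes "k \<ge> 1"
  shows "search_cost n k \<le> max 1 n * (10 * k + 1) ^ (5 * k)"
proof -
  define B where "B = 10 * k + 1"
  define P where "P = B ^ k"
  define N where "N = max 1 n"
  define Z where "Z = N * P"
  define Y where "Y = P * Z"
  have BP: "B \<le> P"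
    unfolding P_def using assms power_increasing[of 1 k B] by (simp add: B_def)
  have kP: "k \<le> P" "11 \<le> P" using BP assms by (simp_all add: B_def)
  have N: "1 \<le> N" "n \<le> N" by (simp_all add: N_def)
  have "B * n \<le> P * N"
    using BP N by (intro mult_le_mono)
  then have Z: "N \<le> Z" "P \<le> Z" "B * n \<le> Z"
    using kP N by (simp_all add: Z_def mult.commute)
  have Y: "k * Z \<le> Y" "Z \<le> Y" "Y \<le> P * Y"
    using kP by (simp_all add: Y_def)
  have "k * (15 + 3 * P + 3 * n + 3 * k + B * (8 * n + 6)) \<le> k * (38 * Z)"
    using Z kP BP N by (intro mult_le_mono) (auto simp: algebra_simps)
  then have "climb_cost n k B P + (8 + 3 * k) \<le> 53 * Y"
    using Y Z kP N unfolding climb_cost_def by linarith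
  then have "P * (climb_cost n k B P + (8 + 3 * k)) \<le> P * (53 * Y)"
    by (rule mult_le_mono2)
  moreover have "k * B \<le> P * Y"
    using kP(1) BP Z(2) Y(2) by (intro mult_le_mono) auto
  then have "4 + 6 * k + 3 * (k * B) \<le> 13 * (P * Y)"
    using Y Z kP N by linarith
  then have "4 + k * (6 + 3 * B) \<le> 13 * (P * Y)"
    by (simp add: algebra_simps)
  ultimately have "search_cost n k \<le> 66 * (P * Y)"
    unfolding search_cost_def Let_def B_def[symmetric] P_def[symmetric] by linarith
  also have "\<dots> \<le> (P * P) * (P * Y)"
    using mult_le_mono[OF kP(2) kP(2)] by (intro mult_le_mono1) simp
  also have "\<dots> = N * P ^ 5"
    by (simp add: Y_def Z_def eval_nat_numeral)
  also have "P ^ 5 = B ^ (5 * k)"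
    by (simp add: P_def mult.commute flip: power_mult)
  finally show ?thesis
    by (simp add: N_def B_def)
qed

theorem mainTheorem1:
  shows "\<exists>(P :: com) (g :: nat \<Rightarrow> real) (d :: nat).
    g \<in> O(\<lambda>k. real k * ln (real k) ^ d) \<and>
    (\<forall>(n :: nat) (k :: nat) (E :: 'a set) (e :: nat \<Rightarrow> 'a) (f :: 'a set \<Rightarrow> real).
       k \<ge> 1 \<longrightarrow> bij_betw e {..<n} E \<longrightarrow>
       (\<forall>S. S \<subseteq> E \<longrightarrow> f S \<ge> 0) \<longrightarrow> submodular_on E f \<longrightarrow>
         lossless_spmf (run P e f n k) \<and>
         (\<forall>s \<in> set_spmf (run P e f n k).
            e ` out_set s \<subseteq> E \<and> card (e ` out_set s) \<le> k \<and>
            real (steps s) \<le> 2 powr g k * real (max 1 n) \<and>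
            real (queries s) \<le> 2 powr g k * real (max 1 n)) \<and>
         (LINT s|measure_spmf (run P e f n k). f (e ` out_set s))
           \<ge> 0.539 * Max (f ` {Y. Y \<subseteq> E \<and> card Y \<le> k}))"
proof (intro exI conjI allI impI)
  let ?g = "\<lambda>k. 5 * real k * log 2 (10 * real k + 1)"
  show "?g \<in> O(\<lambda>k. real k * ln (real k) ^ 1)"
    by real_asymp
  fix n k :: nat and E :: "'a set" and e :: "nat \<Rightarrow> 'a" and f :: "'a set \<Rightarrow> real"
  assume k: "k \<ge> 1" and e: "bij_betw e {..<n} E"
    and nonneg: "\<forall>S. S \<subseteq> E \<longrightarrow> f S \<ge> 0" and sub: "submodular_on E f"
  define h where "h I = f (e ` I)" for I
  have inj: "inj_on e {..<n}" and E: "E = e ` {..<n}"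
    using e by (auto simp: bij_betw_def)
  have h_nonneg: "0 \<le> h S" if "S \<subseteq> {..<n}" for S
    using nonneg image_mono[OF that, of e] E by (simp add: h_def)
  have h_sub: "submodular_on {..<n} h"
    unfolding submodular_on_def
  proof (intro allI impI, elim conjE)
    fix S T i assume *: "S \<subseteq> T" "T \<subseteq> {..<n}" "i \<in> {..<n} - T"
    then have "e i \<in> E - e ` T"
      using inj E by (auto dest: inj_onD)
    then show "h (insert i T) - h T \<le> h (insert i S) - h S"
      using sub * E unfolding submodular_on_def h_def by (simp add: image_mono)
  qed
  define I0 where "I0 = ints (init_state n k)"
  have init: "init_state n k = mem I0 (\<lambda>_ _. 0) 0 0"
    by (simp add: I0_def init_state_def iwrite_def)
  let ?B = "10 * k + 1"
  have "reaches h search_com I0 (\<lambda>_ _. 0) (best_so_far h n k ?B (?B ^ k)) (search_cost n k)"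
    using h_nonneg[of "{}"] by (intro reaches_search) (simp_all add: I0_def init_state_def iwrite_def)
  then obtain I R st qu where exec: "exec h search_com (init_state n k) = return_spmf (mem I R st qu)"
    and cost: "st \<le> search_cost n k" "qu \<le> search_cost n k"
    and best: "best_so_far h n k ?B (?B ^ k) I R"
    unfolding reaches_def init by (metis add_0)
  define s where "s = mem I R st qu"
  have run: "run search_com e f n k = return_spmf s"
    using exec by (simp add: run_def s_def flip: h_def)
  have out: "out_set s = I ''out'' ` {..<I ''len'' 0}"
    by (simp add: out_set_def listed_set_def s_def)
  show "lossless_spmf (run search_com e f n k)"
    by (simp add: run)
  have "card (e ` out_set s) \<le> I ''len'' 0"
    using card_image_le[of "{..<I ''len'' 0}" "\<lambda>l. e (I ''out'' l)"] by (simp add: out image_image)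
  then have card: "card (e ` out_set s) \<le> k"
    using best by (simp add: best_so_far_def)
  have "2 powr ?g k = real (?B ^ (5 * k))"
  proof -
    have "?g k = log 2 (real (?B ^ (5 * k)))"
      by (subst of_nat_power, subst log_nat_power) (simp_all add: add.commute)
    then show ?thesis
      by (simp del: of_nat_power of_nat_add)
  qed
  then have "real (search_cost n k) \<le> 2 powr ?g k * real (max 1 n)"
    using search_cost_le[OF k, of n] by (metis mult.commute of_nat_le_iff of_nat_mult)
  then have "real st \<le> 2 powr ?g k * real (max 1 n)" "real qu \<le> 2 powr ?g k * real (max 1 n)"
    using cost by linarith+
  moreover have "e ` out_set s \<subseteq> E"
    using best by (auto simp: best_so_far_def out E)
  ultimately show "\<forall>s \<in> set_spmf (run search_com e f n k).
            e ` out_set s \<subseteq> E \<and> card (e ` out_set s) \<le> k \<and>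
            real (steps s) \<le> 2 powr ?g k * real (max 1 n) \<and>
            real (queries s) \<le> 2 powr ?g k * real (max 1 n)"
    using card by (simp add: run s_def)
  let ?F = "{Y. Y \<subseteq> E \<and> card Y \<le> k}"
  have "finite ?F" "?F \<noteq> {}"
    using E by (auto intro: finite_subset[of _ "Pow E"])
  then have "Max (f ` ?F) \<in> f ` ?F"
    by (intro Max_in) auto
  then obtain Y0 where Y0: "Y0 \<subseteq> E" "card Y0 \<le> k" "f Y0 = Max (f ` ?F)"
    by auto
  then obtain Y where Y: "Y \<subseteq> {..<n}" "Y0 = e ` Y"
    unfolding E by (meson subset_imageE)
  have "card Y \<le> k"
    using Y0(2) Y inj by (simp add: card_image inj_on_subset)
  then obtain q where q: "q < ?B ^ k"
    "h (climb h n ?B k {} q) \<ge> decay k k * h {} + gain k (10 * k) k * h (Y \<union> {})"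
    using climb_ge[OF h_sub h_nonneg Y(1) _ k, of "10 * k" "{}" k] k by auto
  have "0.539 * h Y \<le> gain k (10 * k) k * h Y"
    using gain_ge_0539[OF k] h_nonneg[OF Y(1)] by (rule mult_right_mono)
  also have "\<dots> \<le> h (climb h n ?B k {} q)"
    using q(2) mult_nonneg_nonneg[OF decay_nonneg[OF k, of k] h_nonneg[of "{}"]] by simp
  also have "\<dots> \<le> h (out_set s)"
    using best q(1) unfolding best_so_far_def out by (meson order_trans)
  finally show "0.539 * Max (f ` ?F) \<le> (LINT s|measure_spmf (run search_com e f n k). f (e ` out_set s))"
    using Y0(3) Y(2) by (simp add: run h_def measure_spmf_return_spmf integral_return)
qed

end
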